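(* Let $CC$ be a C-system. There is a bijection between the set of $(\Pi,\lambda)$-structures on $CC$ and the set of Cartmell-Streicher structures on $CC$. Explicitly, the following assignment $(\Pi,\lambda)\mapsto(\mathbf{\Pi},Ap)$ is a well-defined bijection from the set of $(\Pi,\lambda)$-structures to the set of Cartmell-Streicher structures. For $B\in Ob_{\ge 2}$ write $A=ft(B)$, $\Gamma=ft^2(B)$ and set $\mathbf{\Pi}(B)=\Pi_{\Gamma}(B)$. Put $P=\mathbf{\Pi}(B)$, let $\delta:P\to P\times_{\Gamma}P$ be the diagonal, i.e. the unique morphism with $\delta\circ p_{P\times_{\Gamma}P}=Id_P$ and $\delta\circ q(p_P,P)=Id_P$, let $ap_B$ be the unique element of $\widetilde{\mathcal{O}b}_2(P)$ with $\partial(ap_B)=P\times_{\Gamma}B$ and $\lambda_{P}(ap_B)=\delta$, and set $$Ap_B=exch(A,P;\Gamma)\circ ap_B\circ q(p_P,B):A\times_{\Gamma}\mathbf{\Pi}(B)\to B.$$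
   Context: Composition is written in diagrammatic order: for $f:X\to Y$, $g:Y\to Z$, the composite is $f\circ g:X\to Z$. A C-system $CC$ consists of a category with set of objects $Ob$ and set of morphisms $Mor$, functions $l:Ob\to\mathbb{N}$ and $ft:Ob\to Ob$, an object $pt$, for each $X$ a morphism $p_X:X\to ft(X)$, and for each $X$ with $l(X)>0$ and each $f:Y\to ft(X)$ an object $f^*(X)$ and a morphism $q(f,X):f^*(X)\to X$, such that: $l^{-1}(0)=\{pt\}$; $l(ft(X))=l(X)-1$ if $l(X)>0$; $ft(pt)=pt$; $pt$ is a final object; if $l(X)>0$ and $f:Y\to ft(X)$, then $l(f^*(X))>0$, $ft(f^*(X))=Y$, $p_{f^*(X)}\circ f=q(f,X)\circ p_X$ and this square is a pullback; $Id_{ft(X)}^*(X)=X$ and $q(Id_{ft(X)},X)=Id_X$; for $g:Z\to Y$ and $f:Y\to ft(X)$, $(g\circ f)^*(X)=g^*(f^*(X))$ and $q(g\circ f,X)=q(g,f^*(X))\circ q(f,X)$. $X\ge Y$ ("$X$ is over $Y$") means $l(X)\ge l(Y)$ and $Y=ft^{l(X)-l(Y)}(X)$; $X>Y$ means $X\ge Y$ and $l(X)>l(Y)$. For $X\ge Y$, $p(X,Y):X\to Y$ is the composite of canonical morphisms: $p(X,X)=Id_X$, $p(X,Y)=p_X\circ p(ft(X),Y)$ if $X>Y$. For $X\ge\Gamma$ and $f:\Gamma'\to\Gamma$, $f^*(X)$ and $q(f,X):f^*(X)\to X$ are defined recursively by $f^*(\Gamma)=\Gamma'$, $q(f,\Gamma)=f$,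 and, for $X>\Gamma$, $f^*(X)=q(f,ft(X))^*(X)$, $q(f,X)=q(q(f,ft(X)),X)$. For $X,Y\ge\Gamma$, $X\times_{\Gamma}Y=p(X,\Gamma)^*(Y)$ (an object over $X$, and a fiber product of $X$ and $Y$ over $\Gamma$ with projections $p(X\times_\Gamma Y,X)$ and $q(p(X,\Gamma),Y)$). $exch(X,Y;\Gamma):X\times_{\Gamma}Y\to Y\times_{\Gamma}X$ is the unique morphism with $exch(X,Y;\Gamma)\circ q(p(Y,\Gamma),X)=p(X\times_{\Gamma}Y,X)$ and $exch(X,Y;\Gamma)\circ p(Y\times_{\Gamma}X,Y)=q(p(X,\Gamma),Y)$. A morphism $a:X\to Y$ is a morphism over $\Gamma$ if $X,Y\ge\Gamma$ and $a\circ p(Y,\Gamma)=p(X,\Gamma)$. For such $a$ and $f:\Gamma'\to\Gamma$, $f^*(a):f^*(X)\to f^*(Y)$ is the unique morphism over $\Gamma'$ with $f^*(a)\circ q(f,Y)=q(f,X)\circ a$. For $p:X\to Y$, $sec(p)=\{s:Y\to X\mid s\circ p=Id_Y\}$. Presheaves: $\mathcal{O}b_n(\Gamma)=\{X\mid l(X)=l(\Gamma)+n,\ ft^n(X)=\Gamma\}$ and $\widetilde{\mathcal{O}b}_n(\Gamma)=\{o\in Mor\mid codom(o)\in\mathcal{O}b_n(\Gamma),\ o\in sec(p_{codom(o)}),\ codom(o)>\Gamma\}$, each with restriction along $f:\Gamma'\to\Gamma$ given by $f^*$; $\partial:\widetilde{\mathcal{O}b}_n\to\mathcal{O}b_n$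 is $\partial(o)=codom(o)$. Also $\widetilde{\mathcal{O}b}=\{o\in Mor\mid o\in sec(p_{codom(o)}),\ codom(o)>pt\}$ and $\partial:\widetilde{\mathcal{O}b}\to Ob$, $\partial(o)=codom(o)$. $Ob_{\ge 2}=\{B\in Ob\mid l(B)\ge 2\}$; for $B\in Ob_{\ge2}$ write $A=ft(B)$, $\Gamma=ft^2(B)$. A $(\Pi,\lambda)$-structure on $CC$ is a pair of morphisms of presheaves $\Pi:\mathcal{O}b_2\to\mathcal{O}b_1$, $\lambda:\widetilde{\mathcal{O}b}_2\to\widetilde{\mathcal{O}b}_1$ such that the square formed by $\lambda$, $\Pi$ and the two morphisms $\partial$ (i.e. $\lambda\circ\partial=\partial\circ\Pi$) commutes and is a pullback. A Cartmell-Streicher structure on $CC$ is a pair $(\mathbf{\Pi},Ap)$ where: (1) $\mathbf{\Pi}:Ob_{\ge2}\to Ob$ is a function such that for all $B\in Ob_{\ge 2}$: (a) $ft(\mathbf{\Pi}(B))=\Gamma$; (b) $f^*(\mathbf{\Pi}(B))=\mathbf{\Pi}(f^*(B))$ for every $f:\Gamma'\to\Gamma$; (2) $Ap$ assigns to each $B\in Ob_{\ge2}$ a morphism $Ap_B:A\times_{\Gamma}\mathbf{\Pi}(B)\to B$ such that: (a) $Ap_B$ is a morphism over $A$; (b) $f^*(Ap_B)=Ap_{f^*(B)}$ for every $f:\Gamma'\to\Gamma$; (c) the function $\partial^{-1}(\mathbf{\Pi}(B))\to\partial^{-1}(B)$, $s\mapsto p_A^*(s)\circ Ap_B$ (fibers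 of $\partial:\widetilde{\mathcal{O}b}\to Ob$), is a bijection. *)

theory Defs
  imports Main "HOL-Library.FuncSet"
begin

section \<open>Categories\<close>

record ('o, 'm) cat =
  Ob :: "'o set"
  Mor :: "'m set"
  src :: "'m \<Rightarrow> 'o"
  tgt :: "'m \<Rightarrow> 'o"
  idm :: "'o \<Rightarrow> 'm"
  cmp :: "'m \<Rightarrow> 'm \<Rightarrow> 'm"  (infixl "\<cdot>\<index>" 70)

text \<open>Composition is in diagrammatic order: for \<open>f : X \<rightarrow> Y\<close> and \<open>g : Y \<rightarrow> Z\<close>, \<open>f \<cdot> g : X \<rightarrow> Z\<close>.\<close>

definition hom :: "('o, 'm, 'z) cat_scheme \<Rightarrow> 'o \<Rightarrow> 'o \<Rightarrow> 'm set" where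
  "hom C X Y = {f \<in> Mor C. src C f = X \<and> tgt C f = Y}"

locale category =
  fixes C :: "('o, 'm, 'z) cat_scheme" (structure)
  assumes src_in: "f \<in> Mor C \<Longrightarrow> src C f \<in> Ob C"
    and tgt_in: "f \<in> Mor C \<Longrightarrow> tgt C f \<in> Ob C"
    and id_in: "X \<in> Ob C \<Longrightarrow> idm C X \<in> hom C X X"
    and cmp_in: "f \<in> hom C X Y \<Longrightarrow> g \<in> hom C Y Z \<Longrightarrow> f \<cdot> g \<in> hom C X Z"
    and id_cmp: "f \<in> hom C X Y \<Longrightarrow> idm C X \<cdot> f = f"
    and cmp_id: "f \<in> hom C X Y \<Longrightarrow> f \<cdot> idm C Y = f"
    and cmp_assoc: "f \<in> hom C W X \<Longrightarrow> g \<in> hom C X Y \<Longrightarrow> h \<in> hom C Y Z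
        \<Longrightarrow> (f \<cdot> g) \<cdot> h = f \<cdot> (g \<cdot> h)"

definition final_object :: "('o, 'm, 'z) cat_scheme \<Rightarrow> 'o \<Rightarrow> bool" where
  "final_object C T \<longleftrightarrow> T \<in> Ob C \<and> (\<forall>X\<in>Ob C. \<exists>!f. f \<in> hom C X T)"

text \<open>\<open>is_pullback C a b f g\<close>: the square \<open>a : P \<rightarrow> X\<close>, \<open>b : P \<rightarrow> Y\<close>, \<open>f : X \<rightarrow> Z\<close>, \<open>g : Y \<rightarrow> Z\<close>
  commutes and is a pullback.\<close>

definition is_pullback :: "('o, 'm, 'z) cat_scheme \<Rightarrow> 'm \<Rightarrow> 'm \<Rightarrow> 'm \<Rightarrow> 'm \<Rightarrow> bool" where
  "is_pullback C a b f g \<longleftrightarrow>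
     a \<in> Mor C \<and> b \<in> Mor C \<and> f \<in> Mor C \<and> g \<in> Mor C \<and>
     src C a = src C b \<and> tgt C a = src C f \<and> tgt C b = src C g \<and> tgt C f = tgt C g \<and>
     a \<cdot>\<^bsub>C\<^esub> f = b \<cdot>\<^bsub>C\<^esub> g \<and>
     (\<forall>T\<in>Ob C. \<forall>x\<in>hom C T (tgt C a). \<forall>y\<in>hom C T (tgt C b). x \<cdot>\<^bsub>C\<^esub> f = y \<cdot>\<^bsub>C\<^esub> g \<longrightarrow>
        (\<exists>!u. u \<in> hom C T (src C a) \<and> u \<cdot>\<^bsub>C\<^esub> a = x \<and> u \<cdot>\<^bsub>C\<^esub> b = y))"


section \<open>Presheaves of sets\<close>

record ('o, 'm, 'x) psh =
  sect :: "'o \<Rightarrow> 'x set"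
  restr :: "'m \<Rightarrow> 'x \<Rightarrow> 'x"

definition presheaf :: "('o, 'm, 'z) cat_scheme \<Rightarrow> ('o, 'm, 'x) psh \<Rightarrow> bool" where
  "presheaf C F \<longleftrightarrow>
     (\<forall>X\<in>Ob C. \<forall>Y\<in>Ob C. \<forall>f\<in>hom C X Y. \<forall>s\<in>sect F Y. restr F f s \<in> sect F X) \<and>
     (\<forall>X\<in>Ob C. \<forall>s\<in>sect F X. restr F (idm C X) s = s) \<and>
     (\<forall>X\<in>Ob C. \<forall>Y\<in>Ob C. \<forall>Z\<in>Ob C. \<forall>f\<in>hom C X Y. \<forall>g\<in>hom C Y Z. \<forall>s\<in>sect F Z.
        restr F (f \<cdot>\<^bsub>C\<^esub> g) s = restr F f (restr F g s))"

text \<open>Morphisms are families of extensional functions, so that HOL equality of such families is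
  equality of morphisms of presheaves.\<close>

definition psh_mor ::
    "('o, 'm, 'z) cat_scheme \<Rightarrow> ('o, 'm, 'x) psh \<Rightarrow> ('o, 'm, 'y) psh \<Rightarrow> ('o \<Rightarrow> 'x \<Rightarrow> 'y) set" where
  "psh_mor C F G =
     {\<alpha> \<in> (\<Pi>\<^sub>E X\<in>Ob C. sect F X \<rightarrow>\<^sub>E sect G X).
        \<forall>X\<in>Ob C. \<forall>Y\<in>Ob C. \<forall>f\<in>hom C X Y. \<forall>s\<in>sect F Y.
          \<alpha> X (restr F f s) = restr G f (\<alpha> Y s)}"

text \<open>Diagrammatic composite of \<open>\<alpha>\<close> (with domain \<open>F\<close>) and \<open>\<beta>\<close>.\<close>

definition psh_cmp :: "('o, 'm, 'z) cat_scheme \<Rightarrow> ('o, 'm, 'x) psh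
    \<Rightarrow> ('o \<Rightarrow> 'x \<Rightarrow> 'y) \<Rightarrow> ('o \<Rightarrow> 'y \<Rightarrow> 'w) \<Rightarrow> ('o \<Rightarrow> 'x \<Rightarrow> 'w)" where
  "psh_cmp C F \<alpha> \<beta> = (\<lambda>X\<in>Ob C. compose (sect F X) (\<beta> X) (\<alpha> X))"

text \<open>The square \<open>a : P \<rightarrow> F\<close>, \<open>b : P \<rightarrow> G\<close>, \<open>f : F \<rightarrow> H\<close>, \<open>g : G \<rightarrow> H\<close> of presheaves commutes and is a
  pullback. A definition cannot quantify over types, so the test presheaves \<open>T\<close> take values in sets
  of elements of \<open>'m\<close>. As representable presheaves are of this kind, this gives the universal
  property for test presheaves over every type, and it is also equivalent to the square being a
  pullback at each object: see the lemmas below.\<close>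

definition psh_pullback ::
    "('o, 'm, 'z) cat_scheme \<Rightarrow> ('o, 'm, 'p) psh \<Rightarrow> ('o, 'm, 'x) psh \<Rightarrow> ('o, 'm, 'y) psh \<Rightarrow>
     ('o \<Rightarrow> 'p \<Rightarrow> 'x) \<Rightarrow> ('o \<Rightarrow> 'p \<Rightarrow> 'y) \<Rightarrow> ('o \<Rightarrow> 'x \<Rightarrow> 'w) \<Rightarrow> ('o \<Rightarrow> 'y \<Rightarrow> 'w) \<Rightarrow> bool" where
  "psh_pullback C P F G a b f g \<longleftrightarrow>
     psh_cmp C P a f = psh_cmp C P b g \<and>
     (\<forall>T :: ('o, 'm, 'm) psh. presheaf C T \<longrightarrow>
        (\<forall>x\<in>psh_mor C T F. \<forall>y\<in>psh_mor C T G. psh_cmp C T x f = psh_cmp C T y g \<longrightarrow>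
           (\<exists>!u. u \<in> psh_mor C T P \<and> psh_cmp C T u a = x \<and> psh_cmp C T u b = y)))"

lemma psh_cmp_eq_iff:
  "psh_cmp C P a f = psh_cmp C P b g \<longleftrightarrow> (\<forall>X\<in>Ob C. \<forall>s\<in>sect P X. f X (a X s) = g X (b X s))"
  by (auto simp: psh_cmp_def compose_def restrict_def fun_eq_iff)

lemma psh_cmp_eq_mor_iff:
  assumes "x \<in> psh_mor C T F"
  shows "psh_cmp C T u a = x \<longleftrightarrow> (\<forall>X\<in>Ob C. \<forall>s\<in>sect T X. a X (u X s) = x X s)"
proof -
  have "x X = undefined" if "X \<notin> Ob C" for X
    using assms that unfolding psh_mor_def PiE_def extensional_def by blast
  moreover have "x X s = undefined" if "X \<in> Ob C" "s \<notin> sect T X" for X s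
    using assms that unfolding psh_mor_def PiE_def extensional_def Pi_def by blast
  ultimately show ?thesis
    by (auto simp: psh_cmp_def compose_def restrict_def fun_eq_iff)
qed

lemma psh_mor_eqI:
  assumes "x \<in> psh_mor C T F" "y \<in> psh_mor C T F"
    and "\<And>X s. X \<in> Ob C \<Longrightarrow> s \<in> sect T X \<Longrightarrow> x X s = y X s"
  shows "x = y"
proof (rule ext)
  fix X
  have x: "x \<in> (\<Pi>\<^sub>E X\<in>Ob C. sect T X \<rightarrow>\<^sub>E sect F X)" and y: "y \<in> (\<Pi>\<^sub>E X\<in>Ob C. sect T X \<rightarrow>\<^sub>E sect F X)"
    using assms by (auto simp: psh_mor_def)
  show "x X = y X"
  proof (cases "X \<in> Ob C")
    case True
    then have "x X \<in> sect T X \<rightarrow>\<^sub>E sect F X" "y X \<in> sect T X \<rightarrow>\<^sub>E sect F X"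
      using PiE_mem[OF x] PiE_mem[OF y] by blast+
    then show ?thesis using assms(3)[OF True] by (rule PiE_ext)
  next
    case False
    then show ?thesis using PiE_arb[OF x] PiE_arb[OF y] by simp
  qed
qed

lemma psh_mor_sect:
  "\<alpha> \<in> psh_mor C F G \<Longrightarrow> X \<in> Ob C \<Longrightarrow> s \<in> sect F X \<Longrightarrow> \<alpha> X s \<in> sect G X"
  unfolding psh_mor_def PiE_def Pi_def by blast

lemma psh_mor_nat:
  "\<alpha> \<in> psh_mor C F G \<Longrightarrow> X \<in> Ob C \<Longrightarrow> Y \<in> Ob C \<Longrightarrow> f \<in> hom C X Y \<Longrightarrow> s \<in> sect F Y
    \<Longrightarrow> \<alpha> X (restr F f s) = restr G f (\<alpha> Y s)"
  unfolding psh_mor_def by blast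

lemma psh_morI:
  assumes "\<And>X s. X \<in> Ob C \<Longrightarrow> s \<in> sect F X \<Longrightarrow> \<alpha> X s \<in> sect G X"
    and "\<And>X Y f s. X \<in> Ob C \<Longrightarrow> Y \<in> Ob C \<Longrightarrow> f \<in> hom C X Y \<Longrightarrow> s \<in> sect F Y \<Longrightarrow>
           restr F f s \<in> sect F X \<and> \<alpha> X (restr F f s) = restr G f (\<alpha> Y s)"
  shows "(\<lambda>X\<in>Ob C. \<lambda>s\<in>sect F X. \<alpha> X s) \<in> psh_mor C F G"
  using assms unfolding psh_mor_def by auto

lemma psh_pullback_universal_if_pointwise:
  fixes T :: "('o, 'm, 't) psh"
  assumes "presheaf C T" "presheaf C P"
    and a: "a \<in> psh_mor C P F" and b: "b \<in> psh_mor C P G"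
    and pw: "\<And>X s t. X \<in> Ob C \<Longrightarrow> s \<in> sect F X \<Longrightarrow> t \<in> sect G X \<Longrightarrow> f X s = g X t \<Longrightarrow>
               \<exists>!r. r \<in> sect P X \<and> a X r = s \<and> b X r = t"
    and x: "x \<in> psh_mor C T F" and y: "y \<in> psh_mor C T G"
    and eq: "psh_cmp C T x f = psh_cmp C T y g"
  shows "\<exists>!u. u \<in> psh_mor C T P \<and> psh_cmp C T u a = x \<and> psh_cmp C T u b = y"
proof -
  define U where "U X s = (THE r. r \<in> sect P X \<and> a X r = x X s \<and> b X r = y X s)" for X s
  have ex: "\<exists>!r. r \<in> sect P X \<and> a X r = x X s \<and> b X r = y X s" if "X \<in> Ob C" "s \<in> sect T X" for X s
    using pw[OF that(1) psh_mor_sect[OF x that] psh_mor_sect[OF y that]] eq that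
    unfolding psh_cmp_eq_iff by blast
  have U: "U X s \<in> sect P X \<and> a X (U X s) = x X s \<and> b X (U X s) = y X s"
    if "X \<in> Ob C" "s \<in> sect T X" for X s
    unfolding U_def by (rule theI'[OF ex[OF that]])
  define u where "u = (\<lambda>X\<in>Ob C. \<lambda>s\<in>sect T X. U X s)"
  have u_eq: "u X s = U X s" if "X \<in> Ob C" "s \<in> sect T X" for X s
    using that by (simp add: u_def)
  have "u \<in> psh_mor C T P" unfolding u_def
  proof (rule psh_morI)
    fix X Y f s assume H: "X \<in> Ob C" "Y \<in> Ob C" "f \<in> hom C X Y" "s \<in> sect T Y"
    have 1: "restr T f s \<in> sect T X" using assms(1) H unfolding presheaf_def by blast
    have 2: "restr P f (U Y s) \<in> sect P X" using assms(2) H U unfolding presheaf_def by blast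
    have 3: "a X (restr P f (U Y s)) = x X (restr T f s)"
      using psh_mor_nat[OF a H(1-3)] psh_mor_nat[OF x H] U[OF H(2,4)] by metis
    have 4: "b X (restr P f (U Y s)) = y X (restr T f s)"
      using psh_mor_nat[OF b H(1-3)] psh_mor_nat[OF y H] U[OF H(2,4)] by metis
    have "U X (restr T f s) = restr P f (U Y s)"
      using ex[OF H(1) 1] U[OF H(1) 1] 2 3 4 by blast
    then show "restr T f s \<in> sect T X \<and> U X (restr T f s) = restr P f (U Y s)" using 1 by blast
  qed (use U in blast)
  moreover have "psh_cmp C T u a = x" "psh_cmp C T u b = y"
    using U u_eq by (simp_all add: psh_cmp_eq_mor_iff[OF x] psh_cmp_eq_mor_iff[OF y])
  moreover have "v = u" if v: "v \<in> psh_mor C T P" "psh_cmp C T v a = x" "psh_cmp C T v b = y" for v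
  proof (rule psh_mor_eqI[OF v(1) \<open>u \<in> psh_mor C T P\<close>])
    fix X s assume H: "X \<in> Ob C" "s \<in> sect T X"
    have "a X (v X s) = x X s" "b X (v X s) = y X s"
      using v(2,3) H unfolding psh_cmp_eq_mor_iff[OF x] psh_cmp_eq_mor_iff[OF y] by blast+
    then show "v X s = u X s"
      using ex[OF H] U[OF H] psh_mor_sect[OF v(1) H] u_eq[OF H] by metis
  qed
  ultimately show ?thesis by blast
qed

lemma psh_pullback_iff_pointwise:
  fixes C :: "('o, 'm, 'z) cat_scheme"
  assumes "category C" and P: "presheaf C P" and F: "presheaf C F" and G: "presheaf C G"
    and a: "a \<in> psh_mor C P F" and b: "b \<in> psh_mor C P G"
    and f: "f \<in> psh_mor C F H" and g: "g \<in> psh_mor C G H"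
  shows "psh_pullback C P F G a b f g \<longleftrightarrow>
    psh_cmp C P a f = psh_cmp C P b g \<and>
    (\<forall>X\<in>Ob C. \<forall>s\<in>sect F X. \<forall>t\<in>sect G X. f X s = g X t \<longrightarrow>
       (\<exists>!r. r \<in> sect P X \<and> a X r = s \<and> b X r = t))" (is "_ \<longleftrightarrow> _ \<and> ?pw")
proof
  assume "psh_cmp C P a f = psh_cmp C P b g \<and> ?pw"
  then show "psh_pullback C P F G a b f g"
    unfolding psh_pullback_def
    using psh_pullback_universal_if_pointwise[OF _ P a b, where f = f and g = g] by blast
next
  assume pb: "psh_pullback C P F G a b f g"
  interpret category C by fact
  have ?pw
  proof (intro ballI impI)
    fix X s t assume X: "X \<in> Ob C" and s: "s \<in> sect F X" and t: "t \<in> sect G X" and st: "f X s = g X t"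
    define T :: "('o, 'm, 'm) psh" where "T = \<lparr>sect = (\<lambda>W. hom C W X), restr = (\<lambda>h k. h \<cdot>\<^bsub>C\<^esub> k)\<rparr>"
    have T_simps [simp]: "sect T W = hom C W X" "restr T h k = h \<cdot>\<^bsub>C\<^esub> k" for W h k
      by (simp_all add: T_def)
    have T: "presheaf C T"
      unfolding presheaf_def using cmp_in id_cmp cmp_assoc by auto
    have yon: "(\<lambda>W\<in>Ob C. \<lambda>h\<in>sect T W. restr K h r) \<in> psh_mor C T K"
      if "presheaf C K" "r \<in> sect K X" for K :: "('o, 'm, 'k) psh" and r
      by (rule psh_morI) (use that X cmp_in in \<open>auto simp: presheaf_def\<close>)
    define x where "x = (\<lambda>W\<in>Ob C. \<lambda>h\<in>sect T W. restr F h s)"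
    define y where "y = (\<lambda>W\<in>Ob C. \<lambda>h\<in>sect T W. restr G h t)"
    have x: "x \<in> psh_mor C T F" unfolding x_def by (rule yon[OF F s])
    have y: "y \<in> psh_mor C T G" unfolding y_def by (rule yon[OF G t])
    have "psh_cmp C T x f = psh_cmp C T y g"
      unfolding psh_cmp_eq_iff
    proof (intro ballI)
      fix W h assume W: "W \<in> Ob C" and h: "h \<in> sect T W"
      then have h': "h \<in> hom C W X" by simp
      show "f W (x W h) = g W (y W h)"
        using psh_mor_nat[OF f W X h' s] psh_mor_nat[OF g W X h' t] st W h
        by (simp add: x_def y_def)
    qed
    then have ex1: "\<exists>!u. u \<in> psh_mor C T P \<and> psh_cmp C T u a = x \<and> psh_cmp C T u b = y"
      using pb T x y unfolding psh_pullback_def by blast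
    then obtain u where u: "u \<in> psh_mor C T P" "psh_cmp C T u a = x" "psh_cmp C T u b = y" by blast
    have i: "idm C X \<in> sect T X" using id_in[OF X] by simp
    have "x X (idm C X) = s" "y X (idm C X) = t"
      using X i s t F G by (auto simp: x_def y_def presheaf_def)
    then have "u X (idm C X) \<in> sect P X \<and> a X (u X (idm C X)) = s \<and> b X (u X (idm C X)) = t"
      using u X i psh_mor_sect[OF u(1) X i]
      unfolding psh_cmp_eq_mor_iff[OF x] psh_cmp_eq_mor_iff[OF y] by auto
    moreover have "r = u X (idm C X)" if r: "r \<in> sect P X \<and> a X r = s \<and> b X r = t" for r
    proof -
      define v where "v = (\<lambda>W\<in>Ob C. \<lambda>h\<in>sect T W. restr P h r)"
      have v: "v \<in> psh_mor C T P" unfolding v_def using yon[OF P] r by blast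
      have "a W (v W h) = x W h \<and> b W (v W h) = y W h" if W: "W \<in> Ob C" and h: "h \<in> sect T W" for W h
      proof -
        have h': "h \<in> hom C W X" using h by simp
        show ?thesis
          using psh_mor_nat[OF a W X h', of r] psh_mor_nat[OF b W X h', of r] r W h
          by (simp add: x_def y_def v_def)
      qed
      then have "v = u" using ex1 u v
        unfolding psh_cmp_eq_mor_iff[OF x] psh_cmp_eq_mor_iff[OF y] by blast
      moreover have "v X (idm C X) = r" using X i r P by (auto simp: v_def presheaf_def)
      ultimately show ?thesis by simp
    qed
    ultimately show "\<exists>!r. r \<in> sect P X \<and> a X r = s \<and> b X r = t" by blast
  qed
  then show "psh_cmp C P a f = psh_cmp C P b g \<and> ?pw"
    using pb unfolding psh_pullback_def by blast
qed

lemma psh_pullback_universal: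
  fixes T :: "('o, 'm, 't) psh"
  assumes "category C" "presheaf C P" "presheaf C F" "presheaf C G" "presheaf C T"
    and "a \<in> psh_mor C P F" "b \<in> psh_mor C P G" "f \<in> psh_mor C F H" "g \<in> psh_mor C G H"
    and "psh_pullback C P F G a b f g"
    and "x \<in> psh_mor C T F" "y \<in> psh_mor C T G" "psh_cmp C T x f = psh_cmp C T y g"
  shows "\<exists>!u. u \<in> psh_mor C T P \<and> psh_cmp C T u a = x \<and> psh_cmp C T u b = y"
  by (rule psh_pullback_universal_if_pointwise[where F = F and G = G and f = f and g = g])
     (use assms in \<open>simp_all add: psh_pullback_iff_pointwise\<close>)


section \<open>C-systems\<close>

record ('o, 'm) csys = "('o, 'm) cat" +
  len :: "'o \<Rightarrow> nat"
  ft :: "'o \<Rightarrow> 'o"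
  pt :: "'o"
  pr :: "'o \<Rightarrow> 'm"
  pull1 :: "'m \<Rightarrow> 'o \<Rightarrow> 'o"
  q1 :: "'m \<Rightarrow> 'o \<Rightarrow> 'm"

text \<open>\<open>pr X\<close> is \<open>p\<^sub>X\<close>; \<open>pull1 f X\<close> and \<open>q1 f X\<close> are the structural \<open>f\<^sup>*(X)\<close> and \<open>q(f, X)\<close>, meaningful for
  \<open>len X > 0\<close> and \<open>f : Y \<rightarrow> ft X\<close>. Their extensions to \<open>f : \<Gamma>' \<rightarrow> \<Gamma>\<close> and \<open>X\<close> over \<open>\<Gamma>\<close> are \<open>pull\<close> and \<open>q\<close>
  below.\<close>

locale csystem = category CC for CC :: "('o, 'm) csys" (structure) +
  assumes ft_in: "X \<in> Ob CC \<Longrightarrow> ft CC X \<in> Ob CC"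
    and pr_in: "X \<in> Ob CC \<Longrightarrow> pr CC X \<in> hom CC X (ft CC X)"
    and len_0: "{X \<in> Ob CC. len CC X = 0} = {pt CC}"
    and len_ft: "X \<in> Ob CC \<Longrightarrow> len CC X > 0 \<Longrightarrow> len CC (ft CC X) = len CC X - 1"
    and ft_pt: "ft CC (pt CC) = pt CC"
    and pt_final: "final_object CC (pt CC)"
    and pull1_in: "X \<in> Ob CC \<Longrightarrow> len CC X > 0 \<Longrightarrow> f \<in> hom CC Y (ft CC X) \<Longrightarrow> pull1 CC f X \<in> Ob CC"
    and q1_in: "X \<in> Ob CC \<Longrightarrow> len CC X > 0 \<Longrightarrow> f \<in> hom CC Y (ft CC X)
        \<Longrightarrow> q1 CC f X \<in> hom CC (pull1 CC f X) X"
    and len_pull1: "X \<in> Ob CC \<Longrightarrow> len CC X > 0 \<Longrightarrow> f \<in> hom CC Y (ft CC X)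
        \<Longrightarrow> len CC (pull1 CC f X) > 0"
    and ft_pull1: "X \<in> Ob CC \<Longrightarrow> len CC X > 0 \<Longrightarrow> f \<in> hom CC Y (ft CC X)
        \<Longrightarrow> ft CC (pull1 CC f X) = Y"
    and pullback1: "X \<in> Ob CC \<Longrightarrow> len CC X > 0 \<Longrightarrow> f \<in> hom CC Y (ft CC X)
        \<Longrightarrow> is_pullback CC (pr CC (pull1 CC f X)) (q1 CC f X) f (pr CC X)"
    and pull1_id: "X \<in> Ob CC \<Longrightarrow> len CC X > 0 \<Longrightarrow> pull1 CC (idm CC (ft CC X)) X = X"
    and q1_id: "X \<in> Ob CC \<Longrightarrow> len CC X > 0 \<Longrightarrow> q1 CC (idm CC (ft CC X)) X = idm CC X"
    and pull1_cmp: "X \<in> Ob CC \<Longrightarrow> len CC X > 0 \<Longrightarrow> g \<in> hom CC Z Y \<Longrightarrow> f \<in> hom CC Y (ft CC X)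
        \<Longrightarrow> pull1 CC (g \<cdot> f) X = pull1 CC g (pull1 CC f X)"
    and q1_cmp: "X \<in> Ob CC \<Longrightarrow> len CC X > 0 \<Longrightarrow> g \<in> hom CC Z Y \<Longrightarrow> f \<in> hom CC Y (ft CC X)
        \<Longrightarrow> q1 CC (g \<cdot> f) X = q1 CC g (pull1 CC f X) \<cdot> q1 CC f X"

context
  fixes CC :: "('o, 'm) csys" (structure)
begin

definition over :: "'o \<Rightarrow> 'o \<Rightarrow> bool" where
  "over X Y \<longleftrightarrow> X \<in> Ob CC \<and> Y \<in> Ob CC \<and> len CC X \<ge> len CC Y \<and>
     Y = (ft CC ^^ (len CC X - len CC Y)) X"

definition strictly_over :: "'o \<Rightarrow> 'o \<Rightarrow> bool" where
  "strictly_over X Y \<longleftrightarrow> over X Y \<and> len CC X > len CC Y"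

text \<open>The recursions defining \<open>p(X, \<Gamma>)\<close>, \<open>f\<^sup>*(X)\<close> and \<open>q(f, X)\<close> run over \<open>len X - len \<Gamma>\<close>; for the last
  two, \<open>\<Gamma>\<close> is the codomain of \<open>f\<close>.\<close>

primrec proj_iter :: "nat \<Rightarrow> 'o \<Rightarrow> 'm" where
  "proj_iter 0 X = idm CC X"
| "proj_iter (Suc n) X = pr CC X \<cdot> proj_iter n (ft CC X)"

definition proj :: "'o \<Rightarrow> 'o \<Rightarrow> 'm" where
  "proj X Y = proj_iter (len CC X - len CC Y) X"

primrec q_iter :: "nat \<Rightarrow> 'm \<Rightarrow> 'o \<Rightarrow> 'm" where
  "q_iter 0 f X = f"
| "q_iter (Suc n) f X = q1 CC (q_iter n f (ft CC X)) X"

primrec pull_iter :: "nat \<Rightarrow> 'm \<Rightarrow> 'o \<Rightarrow> 'o" where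
  "pull_iter 0 f X = src CC f"
| "pull_iter (Suc n) f X = pull1 CC (q_iter n f (ft CC X)) X"

definition q :: "'m \<Rightarrow> 'o \<Rightarrow> 'm" where
  "q f X = q_iter (len CC X - len CC (tgt CC f)) f X"

definition pull :: "'m \<Rightarrow> 'o \<Rightarrow> 'o" where
  "pull f X = pull_iter (len CC X - len CC (tgt CC f)) f X"

text \<open>\<open>fprod \<Gamma> X Y\<close> is \<open>X \<times>\<^sub>\<Gamma> Y\<close>, and \<open>exch \<Gamma> X Y\<close> is \<open>exch(X, Y; \<Gamma>)\<close>.\<close>

definition fprod :: "'o \<Rightarrow> 'o \<Rightarrow> 'o \<Rightarrow> 'o" where
  "fprod \<Gamma> X Y = pull (proj X \<Gamma>) Y"

definition exch :: "'o \<Rightarrow> 'o \<Rightarrow> 'o \<Rightarrow> 'm" where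
  "exch \<Gamma> X Y = (THE e. e \<in> hom CC (fprod \<Gamma> X Y) (fprod \<Gamma> Y X) \<and>
     e \<cdot> q (proj Y \<Gamma>) X = proj (fprod \<Gamma> X Y) X \<and>
     e \<cdot> proj (fprod \<Gamma> Y X) Y = q (proj X \<Gamma>) Y)"

definition mor_over :: "'o \<Rightarrow> 'm \<Rightarrow> bool" where
  "mor_over \<Gamma> a \<longleftrightarrow> a \<in> Mor CC \<and> over (src CC a) \<Gamma> \<and> over (tgt CC a) \<Gamma> \<and>
     a \<cdot> proj (tgt CC a) \<Gamma> = proj (src CC a) \<Gamma>"

text \<open>\<open>f\<^sup>*(a)\<close>, for \<open>f : \<Gamma>' \<rightarrow> \<Gamma>\<close> and a morphism \<open>a\<close> over \<open>\<Gamma>\<close>.\<close>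

definition pull_mor :: "'m \<Rightarrow> 'm \<Rightarrow> 'm" where
  "pull_mor f a = (THE b. b \<in> hom CC (pull f (src CC a)) (pull f (tgt CC a)) \<and>
     mor_over (src CC f) b \<and> b \<cdot> q f (tgt CC a) = q f (src CC a) \<cdot> a)"

definition sec :: "'m \<Rightarrow> 'm set" where
  "sec p = {s \<in> hom CC (tgt CC p) (src CC p). s \<cdot> p = idm CC (tgt CC p)}"


subsection \<open>The presheaves of iterated families and of their sections\<close>

definition Ob_psh :: "nat \<Rightarrow> ('o, 'm, 'o) psh" where
  "Ob_psh n = \<lparr>sect = (\<lambda>\<Gamma>. {X \<in> Ob CC. len CC X = len CC \<Gamma> + n \<and> (ft CC ^^ n) X = \<Gamma>}),
               restr = pull\<rparr>"

definition Obt_psh :: "nat \<Rightarrow> ('o, 'm, 'm) psh" where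
  "Obt_psh n = \<lparr>sect = (\<lambda>\<Gamma>. {s \<in> Mor CC. tgt CC s \<in> sect (Ob_psh n) \<Gamma> \<and>
                         s \<in> sec (pr CC (tgt CC s)) \<and> strictly_over (tgt CC s) \<Gamma>}),
                restr = pull_mor\<rparr>"

definition bd :: "nat \<Rightarrow> 'o \<Rightarrow> 'm \<Rightarrow> 'o" where
  "bd n = (\<lambda>\<Gamma>\<in>Ob CC. \<lambda>s\<in>sect (Obt_psh n) \<Gamma>. tgt CC s)"

definition Obt :: "'m set" where
  "Obt = {s \<in> Mor CC. s \<in> sec (pr CC (tgt CC s)) \<and> strictly_over (tgt CC s) (pt CC)}"

definition bd_fiber :: "'o \<Rightarrow> 'm set" where
  "bd_fiber X = {s \<in> Obt. tgt CC s = X}"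

definition Ob_ge2 :: "'o set" where
  "Ob_ge2 = {B \<in> Ob CC. len CC B \<ge> 2}"


subsection \<open>The two kinds of structures\<close>

definition Pi_lambda_structures :: "(('o \<Rightarrow> 'o \<Rightarrow> 'o) \<times> ('o \<Rightarrow> 'm \<Rightarrow> 'm)) set" where
  "Pi_lambda_structures =
     {(PI, lam). PI \<in> psh_mor CC (Ob_psh 2) (Ob_psh 1) \<and>
        lam \<in> psh_mor CC (Obt_psh 2) (Obt_psh 1) \<and>
        psh_pullback CC (Obt_psh 2) (Obt_psh 1) (Ob_psh 2) lam (bd 2) (bd 1) PI}"

definition CS_structures :: "(('o \<Rightarrow> 'o) \<times> ('o \<Rightarrow> 'm)) set" where
  "CS_structures =
     {(PI, Ap). PI \<in> Ob_ge2 \<rightarrow>\<^sub>E Ob CC \<and> Ap \<in> Ob_ge2 \<rightarrow>\<^sub>E Mor CC \<and>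
        (\<forall>B\<in>Ob_ge2. let A = ft CC B; \<Gamma> = ft CC A in
           ft CC (PI B) = \<Gamma> \<and>
           (\<forall>\<Gamma>'\<in>Ob CC. \<forall>f\<in>hom CC \<Gamma>' \<Gamma>. pull f (PI B) = PI (pull f B)) \<and>
           Ap B \<in> hom CC (fprod \<Gamma> A (PI B)) B \<and>
           mor_over A (Ap B) \<and>
           (\<forall>\<Gamma>'\<in>Ob CC. \<forall>f\<in>hom CC \<Gamma>' \<Gamma>. pull_mor f (Ap B) = Ap (pull f B)) \<and>
           bij_betw (\<lambda>s. pull_mor (pr CC A) s \<cdot> Ap B) (bd_fiber (PI B)) (bd_fiber B))}"


subsection \<open>From the first kind to the second\<close>

definition is_diagonal :: "'o \<Rightarrow> 'o \<Rightarrow> 'm \<Rightarrow> bool" where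
  "is_diagonal \<Gamma> P d \<longleftrightarrow> d \<in> hom CC P (fprod \<Gamma> P P) \<and>
     d \<cdot> pr CC (fprod \<Gamma> P P) = idm CC P \<and> d \<cdot> q (pr CC P) P = idm CC P"

definition diagonal :: "'o \<Rightarrow> 'o \<Rightarrow> 'm" where
  "diagonal \<Gamma> P = (THE d. is_diagonal \<Gamma> P d)"

text \<open>The property characterising \<open>ap\<^sub>B\<close>, where \<open>\<Gamma> = ft\<^sup>2(B)\<close> and \<open>P = \<Pi>\<^sub>\<Gamma>(B)\<close>.\<close>

definition is_ap :: "('o \<Rightarrow> 'm \<Rightarrow> 'm) \<Rightarrow> 'o \<Rightarrow> 'o \<Rightarrow> 'o \<Rightarrow> 'm \<Rightarrow> bool" where
  "is_ap lam \<Gamma> P B s \<longleftrightarrow> s \<in> sect (Obt_psh 2) P \<and>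
     bd 2 P s = fprod \<Gamma> P B \<and> lam P s = diagonal \<Gamma> P"

definition ap :: "('o \<Rightarrow> 'm \<Rightarrow> 'm) \<Rightarrow> 'o \<Rightarrow> 'o \<Rightarrow> 'o \<Rightarrow> 'm" where
  "ap lam \<Gamma> P B = (THE s. is_ap lam \<Gamma> P B s)"

definition CS_of_Pi_lambda ::
    "('o \<Rightarrow> 'o \<Rightarrow> 'o) \<times> ('o \<Rightarrow> 'm \<Rightarrow> 'm) \<Rightarrow> ('o \<Rightarrow> 'o) \<times> ('o \<Rightarrow> 'm)" where
  "CS_of_Pi_lambda = (\<lambda>(PI, lam).
     (\<lambda>B\<in>Ob_ge2. PI (ft CC (ft CC B)) B,
      \<lambda>B\<in>Ob_ge2. let A = ft CC B; \<Gamma> = ft CC A; P = PI \<Gamma> B in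
        exch \<Gamma> A P \<cdot> ap lam \<Gamma> P B \<cdot> q (pr CC P) B))"

end

end

theory Submission
  imports Defs
begin

text \<open>
  For \<open>B\<close> with \<open>A = ft B\<close> and \<open>\<Gamma> = ft A\<close>, both kinds of structure provide an object \<open>P = \<Pi>(B)\<close> over
  \<open>\<Gamma>\<close>, stable under base change, and a way to identify the sections of \<open>P\<close> with the sections of
  \<open>B\<close>. A \<open>(\<Pi>, \<lambda>)\<close>-structure gives this identification as a natural family of bijections: its square
  is a pullback if and only if \<open>\<lambda>\<close> restricts to a bijection from the sections of each \<open>B\<close> to those of
  \<open>\<Pi>(B)\<close> (\<open>Pi_lambda_structures_iff\<close>). A Cartmell-Streicher structure gives it through the single
  morphism \<open>Ap\<^sub>B\<close>, with which sections are composed.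

  The passage between the two is an instance of the Yoneda lemma. Fix a stable \<open>P\<close>. A stable
  \<open>Ap\<close> yields the natural family \<open>s \<mapsto> p\<^sub>A\<^sup>*(s) \<cdot> Ap\<^sub>B\<close> of maps from the sections of \<open>P(B)\<close> to those of
  \<open>B\<close>. Conversely, a natural family \<open>\<phi>\<close> of such maps is determined by one value for each \<open>B\<close>. Over \<open>P\<close>
  itself, the diagonal is a section of \<open>p\<^sub>P\<^sup>*(P) = P \<times>\<^sub>\<Gamma> P\<close>, and it is the generic one: each section \<open>s\<close>
  of \<open>P\<close> is the base change \<open>s\<^sup>*(\<delta>)\<close> of it. So \<open>\<phi>(s) = s\<^sup>*(\<phi>(\<delta>))\<close>, and \<open>\<phi>(\<delta>) : P \<times>\<^sub>\<Gamma> A \<rightarrow> P \<times>\<^sub>\<Gamma> B\<close>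
  becomes a morphism \<open>A \<times>\<^sub>\<Gamma> P \<rightarrow> B\<close> by exchanging the factors of its source and projecting its target
  to \<open>B\<close>. This is \<open>application_of\<close>, and for \<open>\<phi> = \<lambda>\<^sup>-\<^sup>1\<close> it is the morphism \<open>Ap\<^sub>B\<close> of the theorem.

  The two constructions preserve stability (\<open>evaluate_natural\<close>, \<open>application_of_stable\<close>) and are
  mutually inverse (\<open>evaluate_application_of\<close>, \<open>application_of_evaluate\<close>); as condition (c) on \<open>Ap\<close> says
  exactly that the associated natural family is bijective, the theorem follows. One point needs a
  separate argument: a Cartmell-Streicher structure is only required to satisfy \<open>ft(\<Pi>(B)) = \<Gamma>\<close>, which
  does not by itself exclude \<open>\<Pi>(B) = pt = \<Gamma>\<close>; stability under base change does
  (\<open>CS_structure_positive\<close>).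
\<close>

section \<open>Pullbacks in a category\<close>

context category
begin

lemma cmp_Mor [simp]: "f \<in> Mor C \<Longrightarrow> g \<in> Mor C \<Longrightarrow> tgt C f = src C g \<Longrightarrow> f \<cdot> g \<in> Mor C"
  and src_cmp [simp]: "f \<in> Mor C \<Longrightarrow> g \<in> Mor C \<Longrightarrow> tgt C f = src C g \<Longrightarrow> src C (f \<cdot> g) = src C f"
  and tgt_cmp [simp]: "f \<in> Mor C \<Longrightarrow> g \<in> Mor C \<Longrightarrow> tgt C f = src C g \<Longrightarrow> tgt C (f \<cdot> g) = tgt C g"
  using cmp_in[of f "src C f" "src C g" g "tgt C g"] by (auto simp: hom_def)

lemma id_Mor [simp]: "X \<in> Ob C \<Longrightarrow> idm C X \<in> Mor C"
  and src_id [simp]: "X \<in> Ob C \<Longrightarrow> src C (idm C X) = X"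
  and tgt_id [simp]: "X \<in> Ob C \<Longrightarrow> tgt C (idm C X) = X"
  using id_in[of X] by (auto simp: hom_def)

lemma id_left [simp]: "f \<in> Mor C \<Longrightarrow> src C f = X \<Longrightarrow> idm C X \<cdot> f = f"
  and id_right [simp]: "f \<in> Mor C \<Longrightarrow> tgt C f = X \<Longrightarrow> f \<cdot> idm C X = f"
  using id_cmp cmp_id by (auto simp: hom_def)

lemma src_Ob [simp]: "f \<in> Mor C \<Longrightarrow> src C f \<in> Ob C"
  and tgt_Ob [simp]: "f \<in> Mor C \<Longrightarrow> tgt C f \<in> Ob C"
  using src_in tgt_in by auto

lemma assoc: "f \<in> Mor C \<Longrightarrow> g \<in> Mor C \<Longrightarrow> h \<in> Mor C \<Longrightarrow> tgt C f = src C g \<Longrightarrow> tgt C g = src C h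
    \<Longrightarrow> (f \<cdot> g) \<cdot> h = f \<cdot> (g \<cdot> h)"
  using cmp_assoc[of f "src C f" "src C g" g "src C h" h "tgt C h"] by (auto simp: hom_def)

lemma cmp_cong_left:
  "a \<cdot> b = c \<Longrightarrow> a \<in> Mor C \<Longrightarrow> b \<in> Mor C \<Longrightarrow> x \<in> Mor C \<Longrightarrow> tgt C a = src C b \<Longrightarrow> tgt C b = src C x
    \<Longrightarrow> a \<cdot> (b \<cdot> x) = c \<cdot> x"
  using assoc by metis

lemma pullback_cancel:
  assumes "is_pullback C a b f g" "u \<in> Mor C" "v \<in> Mor C" "src C u = src C v"
    and "tgt C u = src C a" "tgt C v = src C a" "u \<cdot> a = v \<cdot> a" "u \<cdot> b = v \<cdot> b"
  shows "u = v"
proof -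
  have ab: "a \<in> Mor C" "b \<in> Mor C" "f \<in> Mor C" "g \<in> Mor C" "src C a = src C b"
    "tgt C a = src C f" "tgt C b = src C g" "tgt C f = tgt C g" "a \<cdot> f = b \<cdot> g"
    using assms(1) unfolding is_pullback_def by auto
  have "u \<cdot> a \<in> hom C (src C u) (tgt C a)" "u \<cdot> b \<in> hom C (src C u) (tgt C b)"
    using ab assms by (auto simp: hom_def)
  moreover have "(u \<cdot> a) \<cdot> f = (u \<cdot> b) \<cdot> g"
    using ab assms by (simp add: assoc)
  ultimately have "\<exists>!w. w \<in> hom C (src C u) (src C a) \<and> w \<cdot> a = u \<cdot> a \<and> w \<cdot> b = u \<cdot> b"
    using assms(1,2) src_in unfolding is_pullback_def by blast
  then show ?thesis using assms by (auto simp: hom_def)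
qed

lemma pullback_lift:
  assumes "is_pullback C a b f g" "x \<in> Mor C" "y \<in> Mor C" "src C x = src C y"
    and "tgt C x = tgt C a" "tgt C y = tgt C b" "x \<cdot> f = y \<cdot> g"
  obtains u where "u \<in> Mor C" "src C u = src C x" "tgt C u = src C a" "u \<cdot> a = x" "u \<cdot> b = y"
proof -
  have "x \<in> hom C (src C x) (tgt C a)" "y \<in> hom C (src C x) (tgt C b)"
    using assms by (auto simp: hom_def)
  then have "\<exists>!u. u \<in> hom C (src C x) (src C a) \<and> u \<cdot> a = x \<and> u \<cdot> b = y"
    using assms(1) assms(7) src_in[OF assms(2)] unfolding is_pullback_def by blast
  then obtain u where "u \<in> hom C (src C x) (src C a)" "u \<cdot> a = x" "u \<cdot> b = y"
    by blast
  then show ?thesis using that by (auto simp: hom_def)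
qed

lemma pullback_paste:
  assumes 1: "is_pullback C a b f g" and 2: "is_pullback C c d b h"
  shows "is_pullback C (c \<cdot> a) d f (h \<cdot> g)"
proof -
  have ab: "a \<in> Mor C" "b \<in> Mor C" "f \<in> Mor C" "g \<in> Mor C" "src C a = src C b"
    "tgt C a = src C f" "tgt C b = src C g" "tgt C f = tgt C g" "a \<cdot> f = b \<cdot> g"
    using 1 unfolding is_pullback_def by auto
  have cd: "c \<in> Mor C" "d \<in> Mor C" "h \<in> Mor C" "src C c = src C d"
    "tgt C c = src C b" "tgt C d = src C h" "tgt C b = tgt C h" "c \<cdot> b = d \<cdot> h"
    using 2 unfolding is_pullback_def by auto
  have eq: "(c \<cdot> a) \<cdot> f = d \<cdot> (h \<cdot> g)"
    using ab cd by (metis assoc)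
  have ex: "\<exists>!u. u \<in> hom C T (src C c) \<and> u \<cdot> (c \<cdot> a) = x \<and> u \<cdot> d = y"
    if x: "x \<in> hom C T (tgt C a)" and y: "y \<in> hom C T (tgt C d)" and xy: "x \<cdot> f = y \<cdot> (h \<cdot> g)" for T x y
  proof -
    have x': "x \<in> Mor C" "src C x = T" "tgt C x = tgt C a" and y': "y \<in> Mor C" "src C y = T" "tgt C y = tgt C d"
      using x y by (auto simp: hom_def)
    have "x \<cdot> f = (y \<cdot> h) \<cdot> g" using xy ab cd x' y' by (simp add: assoc)
    then obtain v where v: "v \<in> Mor C" "src C v = src C x" "tgt C v = src C a" "v \<cdot> a = x" "v \<cdot> b = y \<cdot> h"
      using pullback_lift[OF 1, of x "y \<cdot> h"] ab cd x' y' by auto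
    obtain u where u: "u \<in> Mor C" "src C u = src C v" "tgt C u = src C c" "u \<cdot> c = v" "u \<cdot> d = y"
      using pullback_lift[OF 2, of v y] ab cd x' y' v by auto
    have "u \<cdot> (c \<cdot> a) = x" using u v ab cd by (metis assoc)
    moreover have "w = u" if w: "w \<in> hom C T (src C c)" "w \<cdot> (c \<cdot> a) = x" "w \<cdot> d = y" for w
    proof -
      have w': "w \<in> Mor C" "src C w = T" "tgt C w = src C c" using w by (auto simp: hom_def)
      have 3: "(w \<cdot> c) \<cdot> a = v \<cdot> a" using w(2) w' v(4) ab cd by (simp add: assoc)
      have "(w \<cdot> c) \<cdot> b = w \<cdot> (d \<cdot> h)" using w' ab cd by (simp add: assoc)
      also have "\<dots> = (w \<cdot> d) \<cdot> h" using w' ab cd by (simp add: assoc)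
      finally have 4: "(w \<cdot> c) \<cdot> b = v \<cdot> b" using w(3) v(5) by simp
      have 5: "w \<cdot> c = v"
        by (rule pullback_cancel[OF 1 _ _ _ _ _ 3 4]) (use w' v(1-3) ab(5) cd(1,4,5) x' in auto)
      show ?thesis
        by (rule pullback_cancel[OF 2]) (use w(3) w' u v(1,2) 5 x' in simp_all)
    qed
    moreover have "u \<in> hom C T (src C c)" using u(1-3) v(2) x'(2) by (simp add: hom_def)
    ultimately show ?thesis using u(5) by blast
  qed
  show ?thesis unfolding is_pullback_def
  proof (intro conjI ballI impI)
    fix T x y assume "x \<in> hom C T (tgt C (c \<cdot> a))" "y \<in> hom C T (tgt C d)" "x \<cdot> f = y \<cdot> (h \<cdot> g)"
    then show "\<exists>!u. u \<in> hom C T (src C (c \<cdot> a)) \<and> u \<cdot> (c \<cdot> a) = x \<and> u \<cdot> d = y"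
      using ex[of x T y] ab(1,5) cd(1,5) by simp
  qed (use ab(1-8) cd(1-7) eq in simp_all)
qed

lemma pullback_idm:
  assumes f: "f \<in> Mor C"
  shows "is_pullback C (idm C (src C f)) f f (idm C (tgt C f))"
  unfolding is_pullback_def
proof (intro conjI ballI impI)
  fix T x y assume "x \<in> hom C T (tgt C (idm C (src C f)))" "y \<in> hom C T (tgt C f)" "x \<cdot> f = y \<cdot> idm C (tgt C f)"
  then have x: "x \<in> Mor C" "src C x = T" "tgt C x = src C f" "x \<cdot> f = y"
    using f by (simp_all add: hom_def)
  show "\<exists>!u. u \<in> hom C T (src C (idm C (src C f))) \<and> u \<cdot> idm C (src C f) = x \<and> u \<cdot> f = y"
  proof (rule ex1I[of _ x])
    fix u assume u: "u \<in> hom C T (src C (idm C (src C f))) \<and> u \<cdot> idm C (src C f) = x \<and> u \<cdot> f = y"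
    then have "u \<in> Mor C" "tgt C u = src C f" using f by (simp_all add: hom_def)
    then have "u \<cdot> idm C (src C f) = u" by (rule id_right)
    then show "u = x" using u by simp
  qed (use f x in \<open>simp_all add: hom_def\<close>)
qed (use f in simp_all)

end

section \<open>Towers of canonical projections\<close>

context csystem
begin

text \<open>Recording that \<open>\<Gamma>\<close> is an object makes the recursive description \<open>fam_0\<close>, \<open>fam_Suc\<close> hold without side
  conditions; all properties of iterated base change are proved by induction along it.\<close>

definition fam :: "nat \<Rightarrow> 'o \<Rightarrow> 'o \<Rightarrow> bool" where
  "fam n X \<Gamma> \<longleftrightarrow> \<Gamma> \<in> Ob CC \<and> X \<in> sect (Ob_psh CC n) \<Gamma>"

lemma fam_iff: "fam n X \<Gamma> \<longleftrightarrow> X \<in> Ob CC \<and> \<Gamma> \<in> Ob CC \<and> len CC X = len CC \<Gamma> + n \<and> (ft CC ^^ n) X = \<Gamma>"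
  by (auto simp: fam_def Ob_psh_def)

lemma fam_0: "fam 0 X \<Gamma> \<longleftrightarrow> X = \<Gamma> \<and> \<Gamma> \<in> Ob CC"
  by (auto simp: fam_iff)

lemma fam_Suc: "fam (Suc n) X \<Gamma> \<longleftrightarrow> X \<in> Ob CC \<and> len CC X > 0 \<and> fam n (ft CC X) \<Gamma>"
  by (auto simp: fam_iff funpow_swap1 ft_in len_ft)

lemma fam_trans: "fam m X Y \<Longrightarrow> fam n Y \<Gamma> \<Longrightarrow> fam (m + n) X \<Gamma>"
  by (induction m arbitrary: X) (auto simp: fam_0 fam_Suc)

text \<open>The relation \<open>over\<close> hides the number of steps, which keeps side conditions free of a variable that
  rewriting could not instantiate; \<open>fam\<close> exposes it for inductions.\<close>

lemma over_iff_fam: "over CC X \<Gamma> \<longleftrightarrow> (\<exists>n. fam n X \<Gamma>)"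
  unfolding over_def fam_iff by (metis add.commute add_diff_cancel_right' le_add2 le_add_diff_inverse)

lemma fam_over: "fam n X \<Gamma> \<Longrightarrow> over CC X \<Gamma>"
  by (auto simp: over_iff_fam)

lemma over_refl [simp]: "X \<in> Ob CC \<Longrightarrow> over CC X X"
  by (auto simp: over_def)

lemma over_trans: "over CC X Y \<Longrightarrow> over CC Y Z \<Longrightarrow> over CC X Z"
  unfolding over_iff_fam using fam_trans by blast

lemma over_base_Ob: "over CC X Y \<Longrightarrow> Y \<in> Ob CC"
  by (auto simp: over_def)

lemma pr_Mor [simp]: "X \<in> Ob CC \<Longrightarrow> pr CC X \<in> Mor CC"
  and src_pr [simp]: "X \<in> Ob CC \<Longrightarrow> src CC (pr CC X) = X"
  and tgt_pr [simp]: "X \<in> Ob CC \<Longrightarrow> tgt CC (pr CC X) = ft CC X"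
  using pr_in[of X] by (auto simp: hom_def)

lemmas [simp] = ft_in

lemma proj_self [simp]: "proj CC X X = idm CC X"
  by (simp add: proj_def)

lemma proj_Suc: "fam (Suc n) X \<Gamma> \<Longrightarrow> proj CC X \<Gamma> = pr CC X \<cdot> proj CC (ft CC X) \<Gamma>"
  by (auto simp: proj_def fam_iff len_ft)

lemma proj_hom_fam: "fam n X \<Gamma> \<Longrightarrow> proj CC X \<Gamma> \<in> hom CC X \<Gamma>"
proof (induction n arbitrary: X)
  case 0 then show ?case by (auto simp: fam_0 hom_def)
next
  case (Suc n)
  have "proj CC (ft CC X) \<Gamma> \<in> hom CC (ft CC X) \<Gamma>" using Suc by (auto simp: fam_Suc)
  then show ?case using Suc.prems proj_Suc[OF Suc.prems] by (auto simp: fam_Suc hom_def)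
qed

lemma proj_Mor [simp]: "over CC X Y \<Longrightarrow> proj CC X Y \<in> Mor CC"
  and src_proj [simp]: "over CC X Y \<Longrightarrow> src CC (proj CC X Y) = X"
  and tgt_proj [simp]: "over CC X Y \<Longrightarrow> tgt CC (proj CC X Y) = Y"
  using proj_hom_fam by (auto simp: over_iff_fam hom_def)

lemma proj_fam1: "fam 1 X \<Gamma> \<Longrightarrow> proj CC X \<Gamma> = pr CC X"
  using proj_Suc[of 0 X \<Gamma>] by (auto simp: fam_Suc fam_0)

lemma proj_trans: "over CC X Y \<Longrightarrow> over CC Y \<Gamma> \<Longrightarrow> proj CC X \<Gamma> = proj CC X Y \<cdot> proj CC Y \<Gamma>"
proof -
  have "proj CC X \<Gamma> = proj CC X Y \<cdot> proj CC Y \<Gamma>" if "fam m X Y" "fam n Y \<Gamma>" for m n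
    using that
  proof (induction m arbitrary: X)
    case 0 then show ?case using fam_over[of n Y \<Gamma>] by (auto simp: fam_0)
  next
    case (Suc m)
    have *: "fam (Suc (m + n)) X \<Gamma>" "fam m (ft CC X) Y" "over CC (ft CC X) Y" "over CC Y \<Gamma>" "X \<in> Ob CC"
      using Suc.prems fam_trans[of "Suc m" X Y n \<Gamma>] fam_over by (auto simp: fam_Suc)
    show ?case
      using * Suc.IH[of "ft CC X"] Suc.prems(2) proj_Suc[OF *(1)] proj_Suc[OF Suc.prems(1)] by (simp add: assoc)
  qed
  then show "over CC X Y \<Longrightarrow> over CC Y \<Gamma> \<Longrightarrow> ?thesis" by (auto simp: over_iff_fam)
qed

section \<open>Iterated base change\<close>

lemma q_self [simp]: "tgt CC f = X \<Longrightarrow> q CC f X = f"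
  by (auto simp: q_def)

lemma pull_self [simp]: "tgt CC f = X \<Longrightarrow> pull CC f X = src CC f"
  by (auto simp: pull_def)

lemma q_Suc: "fam (Suc n) X (tgt CC f) \<Longrightarrow> q CC f X = q1 CC (q CC f (ft CC X)) X"
  and pull_Suc: "fam (Suc n) X (tgt CC f) \<Longrightarrow> pull CC f X = pull1 CC (q CC f (ft CC X)) X"
  by (auto simp: q_def pull_def fam_iff len_ft)

lemma base_change_fam:
  "f \<in> Mor CC \<Longrightarrow> fam n X (tgt CC f) \<Longrightarrow> q CC f X \<in> hom CC (pull CC f X) X \<and> fam n (pull CC f X) (src CC f)"
proof (induction n arbitrary: X)
  case 0 then show ?case by (auto simp: fam_0 hom_def)
next
  case (Suc n)
  have *: "q CC f (ft CC X) \<in> hom CC (pull CC f (ft CC X)) (ft CC X)" "fam n (pull CC f (ft CC X)) (src CC f)"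
    using Suc by (auto simp: fam_Suc)
  show ?case
    using Suc.prems * q1_in[OF _ _ *(1)] pull1_in[OF _ _ *(1)] len_pull1[OF _ _ *(1)] ft_pull1[OF _ _ *(1)]
    by (simp add: q_Suc pull_Suc) (auto simp: fam_Suc)
qed

lemma fam_pull: "f \<in> Mor CC \<Longrightarrow> fam n X (tgt CC f) \<Longrightarrow> fam n (pull CC f X) (src CC f)"
  using base_change_fam by auto

lemma q_Mor [simp]: "f \<in> Mor CC \<Longrightarrow> over CC X (tgt CC f) \<Longrightarrow> q CC f X \<in> Mor CC"
  and src_q [simp]: "f \<in> Mor CC \<Longrightarrow> over CC X (tgt CC f) \<Longrightarrow> src CC (q CC f X) = pull CC f X"
  and tgt_q [simp]: "f \<in> Mor CC \<Longrightarrow> over CC X (tgt CC f) \<Longrightarrow> tgt CC (q CC f X) = X"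
  and over_pull [simp]: "f \<in> Mor CC \<Longrightarrow> over CC X (tgt CC f) \<Longrightarrow> src CC f = \<Gamma>' \<Longrightarrow> over CC (pull CC f X) \<Gamma>'"
  using base_change_fam by (auto simp: over_iff_fam hom_def)

lemma ft_pull: "f \<in> Mor CC \<Longrightarrow> fam (Suc n) X (tgt CC f) \<Longrightarrow> ft CC (pull CC f X) = pull CC f (ft CC X)"
  using ft_pull1[of X "q CC f (ft CC X)" "pull CC f (ft CC X)"] base_change_fam[of f n "ft CC X"]
  by (auto simp: pull_Suc fam_Suc)

text \<open>The square over a tower is the pasting of the squares over its steps.\<close>

lemma base_change_pullback_fam:
  "f \<in> Mor CC \<Longrightarrow> fam n X (tgt CC f) \<Longrightarrow>
    is_pullback CC (proj CC (pull CC f X) (src CC f)) (q CC f X) f (proj CC X (tgt CC f))"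
proof (induction n arbitrary: X)
  case 0
  then have X: "X = tgt CC f" by (simp add: fam_0)
  show ?case using pullback_idm[OF 0(1)] 0(1) by (simp add: X)
next
  case (Suc n)
  have X: "X \<in> Ob CC" "len CC X > 0" "fam n (ft CC X) (tgt CC f)" using Suc.prems by (auto simp: fam_Suc)
  have q: "q CC f (ft CC X) \<in> hom CC (pull CC f (ft CC X)) (ft CC X)"
    using Suc.prems(1) X base_change_fam by auto
  have 1: "is_pullback CC (proj CC (pull CC f (ft CC X)) (src CC f)) (q CC f (ft CC X)) f (proj CC (ft CC X) (tgt CC f))"
    using Suc X by auto
  have 2: "is_pullback CC (pr CC (pull CC f X)) (q CC f X) (q CC f (ft CC X)) (pr CC X)"
    using pullback1[OF X(1,2) q] Suc.prems by (simp add: q_Suc pull_Suc)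
  have "proj CC (pull CC f X) (src CC f) = pr CC (pull CC f X) \<cdot> proj CC (pull CC f (ft CC X)) (src CC f)"
    using proj_Suc[OF fam_pull[OF Suc.prems]] ft_pull[OF Suc.prems] by simp
  then show ?case using pullback_paste[OF 1 2] proj_Suc[OF Suc.prems(2)] by simp
qed

lemma base_change_pullback:
  "f \<in> Mor CC \<Longrightarrow> over CC X (tgt CC f) \<Longrightarrow>
    is_pullback CC (proj CC (pull CC f X) (src CC f)) (q CC f X) f (proj CC X (tgt CC f))"
  using base_change_pullback_fam by (auto simp: over_iff_fam)

lemma base_change_square:
  "f \<in> Mor CC \<Longrightarrow> over CC X (tgt CC f) \<Longrightarrow>
    q CC f X \<cdot> proj CC X (tgt CC f) = proj CC (pull CC f X) (src CC f) \<cdot> f"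
  using base_change_pullback by (auto simp: is_pullback_def)

lemma base_change_cancel:
  assumes "f \<in> Mor CC" "over CC X (tgt CC f)" "u \<in> Mor CC" "v \<in> Mor CC" "src CC u = src CC v"
    and "tgt CC u = pull CC f X" "tgt CC v = pull CC f X"
    and "u \<cdot> proj CC (pull CC f X) (src CC f) = v \<cdot> proj CC (pull CC f X) (src CC f)"
    and "u \<cdot> q CC f X = v \<cdot> q CC f X"
  shows "u = v"
  by (rule pullback_cancel[OF base_change_pullback[OF assms(1,2)]]) (use assms in auto)

lemma base_change_id: "over CC X \<Gamma> \<Longrightarrow> pull CC (idm CC \<Gamma>) X = X \<and> q CC (idm CC \<Gamma>) X = idm CC X"
proof -
  have "pull CC (idm CC \<Gamma>) X = X \<and> q CC (idm CC \<Gamma>) X = idm CC X" if "fam n X \<Gamma>" for n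
    using that
  proof (induction n arbitrary: X)
    case 0 then show ?case by (simp add: fam_0)
  next
    case (Suc n)
    have t: "tgt CC (idm CC \<Gamma>) = \<Gamma>" using Suc.prems by (simp add: fam_iff)
    show ?case using Suc q_Suc[of n X "idm CC \<Gamma>"] pull_Suc[of n X "idm CC \<Gamma>"]
      by (simp add: t fam_Suc q1_id pull1_id)
  qed
  then show "over CC X \<Gamma> \<Longrightarrow> ?thesis" by (auto simp: over_iff_fam)
qed

lemmas pull_id = base_change_id[THEN conjunct1] and q_id = base_change_id[THEN conjunct2]

lemma base_change_cmp:
  assumes "f \<in> Mor CC" "g \<in> Mor CC" "tgt CC g = src CC f" "over CC X (tgt CC f)"
  shows "pull CC (g \<cdot> f) X = pull CC g (pull CC f X) \<and> q CC (g \<cdot> f) X = q CC g (pull CC f X) \<cdot> q CC f X"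
proof -
  have "pull CC (g \<cdot> f) X = pull CC g (pull CC f X) \<and> q CC (g \<cdot> f) X = q CC g (pull CC f X) \<cdot> q CC f X"
    if "fam n X (tgt CC f)" for n
    using that
  proof (induction n arbitrary: X)
    case 0
    then show ?case using assms by (simp add: fam_0)
  next
    case (Suc n)
    have t: "tgt CC (g \<cdot> f) = tgt CC f" using assms by simp
    let ?Y = "ft CC X"
    have Y: "X \<in> Ob CC" "len CC X > 0" "fam n ?Y (tgt CC f)" using Suc.prems by (auto simp: fam_Suc)
    have qf: "q CC f ?Y \<in> hom CC (pull CC f ?Y) ?Y" "fam n (pull CC f ?Y) (src CC f)"
      using base_change_fam assms Y by auto
    have qg: "q CC g (pull CC f ?Y) \<in> hom CC (pull CC g (pull CC f ?Y)) (pull CC f ?Y)"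
      using base_change_fam qf assms by auto
    have fX: "fam (Suc n) (pull CC f X) (tgt CC g)" using fam_pull[OF _ Suc.prems] assms by simp
    show ?case using Suc.IH[OF Y(3)] Suc.prems q_Suc[of n X "g \<cdot> f"] pull_Suc[of n X "g \<cdot> f"] q_Suc[of n X f] pull_Suc[of n X f]
       q_Suc[OF fX] pull_Suc[OF fX] ft_pull[OF _ Suc.prems] assms
       q1_cmp[OF Y(1,2) qg qf(1)] pull1_cmp[OF Y(1,2) qg qf(1)]
      by (simp add: t)
  qed
  then show ?thesis using assms by (auto simp: over_iff_fam)
qed

lemmas pull_cmp = base_change_cmp[THEN conjunct1] and q_cmp = base_change_cmp[THEN conjunct2]

text \<open>The recursion defining \<open>f\<^sup>*(X)\<close> descends from \<open>X\<close> to \<open>\<Gamma>\<close> step by step, so it can be interrupted at any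
  intermediate object \<open>Y\<close>. This reduces questions over \<open>\<Gamma>\<close> to questions over the object one step
  below \<open>X\<close>.\<close>

lemma base_change_tower:
  assumes "f \<in> Mor CC" "over CC Y (tgt CC f)" "over CC X Y"
  shows "pull CC (q CC f Y) X = pull CC f X \<and> q CC (q CC f Y) X = q CC f X"
proof -
  have "pull CC (q CC f Y) X = pull CC f X \<and> q CC (q CC f Y) X = q CC f X" if "fam m X Y" "fam n Y (tgt CC f)" for m n
    using that
  proof (induction m arbitrary: X)
    case 0 then show ?case using assms by (simp add: fam_0)
  next
    case (Suc m)
    have "fam (Suc (m + n)) X (tgt CC f)" using fam_trans[OF Suc.prems] by simp
    moreover have "tgt CC (q CC f Y) = Y" using assms by simp
    ultimately show ?case
      using Suc q_Suc[of "m+n" X f] pull_Suc[of "m+n" X f] q_Suc[of m X "q CC f Y"] pull_Suc[of m X "q CC f Y"]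
      by (simp add: fam_Suc)
  qed
  then show ?thesis using assms by (auto simp: over_iff_fam)
qed

lemmas pull_tower = base_change_tower[THEN conjunct1] and q_tower = base_change_tower[THEN conjunct2]

section \<open>Base change of morphisms\<close>

lemma mor_over_iff: "mor_over CC \<Gamma> a \<longleftrightarrow> a \<in> Mor CC \<and> over CC (src CC a) \<Gamma> \<and> over CC (tgt CC a) \<Gamma> \<and>
     a \<cdot> proj CC (tgt CC a) \<Gamma> = proj CC (src CC a) \<Gamma>"
  by (simp add: mor_over_def)

lemma mor_over_cmp:
  "mor_over CC \<Gamma> a \<Longrightarrow> mor_over CC \<Gamma> b \<Longrightarrow> tgt CC a = src CC b \<Longrightarrow> mor_over CC \<Gamma> (a \<cdot> b)"
  by (simp add: mor_over_iff assoc)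

text \<open>A morphism into \<open>f\<^sup>*(Y)\<close> amounts to its two components, over \<open>\<Gamma>'\<close> and into \<open>Y\<close>, and both are prescribed.\<close>

lemma pull_mor_unique:
  assumes f: "f \<in> Mor CC" and a: "mor_over CC (tgt CC f) a"
  shows "\<exists>!b. b \<in> hom CC (pull CC f (src CC a)) (pull CC f (tgt CC a)) \<and>
     mor_over CC (src CC f) b \<and> b \<cdot> q CC f (tgt CC a) = q CC f (src CC a) \<cdot> a"
proof -
  let ?X = "src CC a" and ?Y = "tgt CC a"
  have a': "a \<in> Mor CC" "over CC ?X (tgt CC f)" "over CC ?Y (tgt CC f)" "a \<cdot> proj CC ?Y (tgt CC f) = proj CC ?X (tgt CC f)"
    using a by (auto simp: mor_over_iff)
  have "proj CC (pull CC f ?X) (src CC f) \<cdot> f = (q CC f ?X \<cdot> a) \<cdot> proj CC ?Y (tgt CC f)"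
    using f a' by (simp add: assoc base_change_square)
  moreover have "proj CC (pull CC f ?X) (src CC f) \<in> Mor CC" "q CC f ?X \<cdot> a \<in> Mor CC"
    "src CC (proj CC (pull CC f ?X) (src CC f)) = src CC (q CC f ?X \<cdot> a)"
    "tgt CC (proj CC (pull CC f ?X) (src CC f)) = tgt CC (proj CC (pull CC f ?Y) (src CC f))"
    "tgt CC (q CC f ?X \<cdot> a) = tgt CC (q CC f ?Y)"
    using f a' by simp_all
  ultimately obtain b where b: "b \<in> Mor CC" "src CC b = src CC (proj CC (pull CC f ?X) (src CC f))"
    "tgt CC b = src CC (proj CC (pull CC f ?Y) (src CC f))"
    "b \<cdot> proj CC (pull CC f ?Y) (src CC f) = proj CC (pull CC f ?X) (src CC f)"
    "b \<cdot> q CC f ?Y = q CC f ?X \<cdot> a"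
    using pullback_lift[OF base_change_pullback[OF f a'(3)]] by metis
  have b': "src CC b = pull CC f ?X" "tgt CC b = pull CC f ?Y" using b(2,3) f a' by simp_all
  show ?thesis
  proof (rule ex1I[of _ b])
    fix c assume c: "c \<in> hom CC (pull CC f ?X) (pull CC f ?Y) \<and> mor_over CC (src CC f) c \<and> c \<cdot> q CC f ?Y = q CC f ?X \<cdot> a"
    then have "c \<in> Mor CC" "src CC c = pull CC f ?X" "tgt CC c = pull CC f ?Y"
      "c \<cdot> proj CC (pull CC f ?Y) (src CC f) = proj CC (pull CC f ?X) (src CC f)"
      by (auto simp: hom_def mor_over_iff)
    then show "c = b"
      by (rule_tac base_change_cancel[OF f a'(3)]) (use b(1,4,5) b' c in simp_all)
  qed (use b(1,4,5) b' f a' in \<open>simp add: hom_def mor_over_iff\<close>)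
qed

lemma
  assumes "f \<in> Mor CC" "mor_over CC (tgt CC f) a"
  shows pull_mor_Mor [simp]: "pull_mor CC f a \<in> Mor CC"
    and src_pull_mor [simp]: "src CC (pull_mor CC f a) = pull CC f (src CC a)"
    and tgt_pull_mor [simp]: "tgt CC (pull_mor CC f a) = pull CC f (tgt CC a)"
    and mor_over_pull_mor [simp]: "src CC f = \<Gamma>' \<Longrightarrow> mor_over CC \<Gamma>' (pull_mor CC f a)"
    and pull_mor_square: "pull_mor CC f a \<cdot> q CC f (tgt CC a) = q CC f (src CC a) \<cdot> a"
  using theI'[OF pull_mor_unique[OF assms]] unfolding pull_mor_def by (auto simp: hom_def)

lemma pull_mor_eqI:
  assumes "f \<in> Mor CC" "mor_over CC (tgt CC f) a" "mor_over CC (src CC f) b"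
    and "src CC b = pull CC f (src CC a)" "tgt CC b = pull CC f (tgt CC a)" "b \<cdot> q CC f (tgt CC a) = q CC f (src CC a) \<cdot> a"
  shows "pull_mor CC f a = b"
  unfolding pull_mor_def
  by (rule the1_equality[OF pull_mor_unique[OF assms(1,2)]]) (use assms in \<open>auto simp: hom_def mor_over_iff\<close>)

lemma pull_mor_id:
  assumes "mor_over CC \<Gamma> a"
  shows "pull_mor CC (idm CC \<Gamma>) a = a"
proof -
  have a: "a \<in> Mor CC" "over CC (src CC a) \<Gamma>" "over CC (tgt CC a) \<Gamma>" "\<Gamma> \<in> Ob CC"
    using assms over_base_Ob by (auto simp: mor_over_iff)
  show ?thesis
    by (rule pull_mor_eqI) (use assms a in \<open>simp_all add: base_change_id\<close>)
qed

lemma pull_mor_comp_base: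
  assumes "f \<in> Mor CC" "g \<in> Mor CC" "tgt CC g = src CC f" "mor_over CC (tgt CC f) a"
  shows "pull_mor CC (g \<cdot> f) a = pull_mor CC g (pull_mor CC f a)"
proof -
  have a: "a \<in> Mor CC" "over CC (src CC a) (tgt CC f)" "over CC (tgt CC a) (tgt CC f)"
    using assms(4) by (auto simp: mor_over_iff)
  have fa: "mor_over CC (tgt CC g) (pull_mor CC f a)" using assms by simp
  have "pull_mor CC g (pull_mor CC f a) \<cdot> q CC (g \<cdot> f) (tgt CC a) =
      (pull_mor CC g (pull_mor CC f a) \<cdot> q CC g (pull CC f (tgt CC a))) \<cdot> q CC f (tgt CC a)"
    using assms a by (simp add: q_cmp assoc)
  also have "\<dots> = (q CC g (pull CC f (src CC a)) \<cdot> pull_mor CC f a) \<cdot> q CC f (tgt CC a)"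
    using pull_mor_square[OF assms(2) fa] assms by simp
  also have "\<dots> = q CC (g \<cdot> f) (src CC a) \<cdot> a"
    using assms a by (simp add: pull_mor_square q_cmp assoc)
  finally show ?thesis
    by (intro pull_mor_eqI) (use assms a in \<open>simp_all add: pull_cmp\<close>)
qed

lemma pull_mor_cmp:
  assumes "f \<in> Mor CC" "mor_over CC (tgt CC f) a" "mor_over CC (tgt CC f) b" "tgt CC a = src CC b"
  shows "pull_mor CC f (a \<cdot> b) = pull_mor CC f a \<cdot> pull_mor CC f b"
proof -
  have ab: "a \<in> Mor CC" "b \<in> Mor CC" "over CC (src CC a) (tgt CC f)" "over CC (src CC b) (tgt CC f)"
    "over CC (tgt CC b) (tgt CC f)"
    using assms by (auto simp: mor_over_iff)
  have "pull_mor CC f a \<cdot> pull_mor CC f b \<cdot> q CC f (tgt CC b) = (pull_mor CC f a \<cdot> q CC f (tgt CC a)) \<cdot> b"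
    using assms ab by (simp add: assoc pull_mor_square[OF assms(1,3)])
  also have "\<dots> = (q CC f (src CC a) \<cdot> a) \<cdot> b"
    by (simp only: pull_mor_square[OF assms(1,2)])
  also have "\<dots> = q CC f (src CC a) \<cdot> (a \<cdot> b)"
    using assms ab by (simp add: assoc)
  finally show ?thesis
    by (intro pull_mor_eqI mor_over_cmp) (use assms ab in simp_all)
qed

lemma mor_over_trans:
  assumes "mor_over CC Y a" "over CC Y \<Gamma>"
  shows "mor_over CC \<Gamma> a"
proof -
  have a: "a \<in> Mor CC" "over CC (src CC a) Y" "over CC (tgt CC a) Y"
    "a \<cdot> proj CC (tgt CC a) Y = proj CC (src CC a) Y"
    using assms by (auto simp: mor_over_iff)
  have "a \<cdot> proj CC (tgt CC a) \<Gamma> = (a \<cdot> proj CC (tgt CC a) Y) \<cdot> proj CC Y \<Gamma>"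
    using a(1-3) assms(2) by (simp add: proj_trans[of _ Y \<Gamma>] assoc)
  also have "\<dots> = proj CC (src CC a) \<Gamma>"
    unfolding a(4) using a(2) assms(2) by (simp add: proj_trans[of _ Y \<Gamma>])
  finally show ?thesis using a over_trans[OF _ assms(2)] by (simp add: mor_over_iff)
qed

lemma pull_mor_tower:
  assumes "f \<in> Mor CC" "over CC Y (tgt CC f)" "mor_over CC Y a"
  shows "pull_mor CC f a = pull_mor CC (q CC f Y) a"
proof -
  have a: "a \<in> Mor CC" "over CC (src CC a) Y" "over CC (tgt CC a) Y" using assms by (auto simp: mor_over_iff)
  have "mor_over CC (pull CC f Y) (pull_mor CC (q CC f Y) a)" "over CC (pull CC f Y) (src CC f)"
    using assms by simp_all
  then have "mor_over CC (src CC f) (pull_mor CC (q CC f Y) a)" by (rule mor_over_trans)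
  moreover have "pull_mor CC (q CC f Y) a \<cdot> q CC f (tgt CC a) = q CC f (src CC a) \<cdot> a"
    using pull_mor_square[of "q CC f Y" a] a assms by (simp add: q_tower)
  ultimately show ?thesis
    by (intro pull_mor_eqI) (use assms a mor_over_trans[OF assms(3,2)] in \<open>simp_all add: pull_tower\<close>)
qed

lemma fam1D: "fam 1 X \<Gamma> \<Longrightarrow> X \<in> Ob CC \<and> \<Gamma> \<in> Ob CC \<and> ft CC X = \<Gamma> \<and> over CC X \<Gamma> \<and> 0 < len CC X \<and> proj CC X \<Gamma> = pr CC X"
  using proj_fam1[of X \<Gamma>] fam_over[of 1 X \<Gamma>] by (auto simp: fam_iff)

lemma fam_Suc_iff: "fam (Suc n) X \<Gamma> \<longleftrightarrow> fam 1 X (ft CC X) \<and> fam n (ft CC X) \<Gamma>"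
  by (auto simp: fam_Suc fam_0)

lemma fam2_iff: "fam 2 B \<Gamma> \<longleftrightarrow> fam 1 B (ft CC B) \<and> fam 1 (ft CC B) \<Gamma>"
  using fam_Suc_iff[of 1 B \<Gamma>] by (simp only: Suc_1)

lemma fam1_pull: "f \<in> Mor CC \<Longrightarrow> fam 1 X (tgt CC f) \<Longrightarrow> src CC f = \<Gamma>' \<Longrightarrow> fam 1 (pull CC f X) \<Gamma>'"
  using fam_pull[of f 1 X] by simp

lemma pr_square: "f \<in> Mor CC \<Longrightarrow> fam 1 X (tgt CC f) \<Longrightarrow> q CC f X \<cdot> pr CC X = pr CC (pull CC f X) \<cdot> f"
  using base_change_square[of f X] fam1D[of X "tgt CC f"] fam1D[OF fam1_pull[of f X]] by simp

lemma pr_cancel: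
  assumes "f \<in> Mor CC" "fam 1 X (tgt CC f)" "u \<in> Mor CC" "v \<in> Mor CC" "src CC u = src CC v"
    and "tgt CC u = pull CC f X" "tgt CC v = pull CC f X"
    and "u \<cdot> pr CC (pull CC f X) = v \<cdot> pr CC (pull CC f X)"
    and "u \<cdot> q CC f X = v \<cdot> q CC f X"
  shows "u = v"
  by (rule base_change_cancel[of f X]) (use assms fam1D[OF assms(2)] fam1D[OF fam1_pull[OF assms(1,2)]] in simp_all)

lemma pr_lift:
  assumes "f \<in> Mor CC" "fam 1 X (tgt CC f)" "x \<in> Mor CC" "y \<in> Mor CC" "src CC x = src CC y"
    and "tgt CC x = src CC f" "tgt CC y = X" "x \<cdot> f = y \<cdot> pr CC X"
  obtains u where "u \<in> Mor CC" "src CC u = src CC x" "tgt CC u = pull CC f X"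
    "u \<cdot> pr CC (pull CC f X) = x" "u \<cdot> q CC f X = y"
proof -
  note X = fam1D[OF assms(2)] fam1D[OF fam1_pull[OF assms(1,2) refl]]
  have "is_pullback CC (pr CC (pull CC f X)) (q CC f X) f (pr CC X)"
    using base_change_pullback[of f X] assms(1) X by simp
  moreover have "tgt CC x = tgt CC (pr CC (pull CC f X))" "tgt CC y = tgt CC (q CC f X)"
    "src CC (pr CC (pull CC f X)) = pull CC f X"
    using assms(1,6,7) X by simp_all
  ultimately show thesis
    using pullback_lift[OF _ assms(3-5)] assms(8) that by metis
qed

section \<open>Sections of canonical projections\<close>

lemma fam_pt: "X \<in> Ob CC \<Longrightarrow> fam (len CC X) X (pt CC)"
proof (induction "len CC X" arbitrary: X)
  case 0
  then show ?case using len_0 by (auto simp: fam_iff)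
next
  case (Suc n)
  then have "n = len CC (ft CC X)" using len_ft[of X] by simp
  then have "fam n (ft CC X) (pt CC)" using Suc(1)[of "ft CC X"] Suc(3) by simp
  moreover have "0 < len CC X" using Suc(2) by linarith
  ultimately have "fam (Suc n) X (pt CC)" unfolding fam_Suc using Suc(3) by blast
  then show ?case using Suc(2) by simp
qed

lemma len_pt: "len CC (pt CC) = 0" "pt CC \<in> Ob CC"
  using len_0 by auto

text \<open>Every object lies over \<open>pt\<close>, strictly so when its length is positive; hence the fibers of \<open>\<partial>\<close> are
  just the sets of sections of the canonical projections.\<close>

lemma bd_fiber_iff:
  assumes "fam 1 X \<Gamma>"
  shows "s \<in> bd_fiber CC X \<longleftrightarrow> s \<in> Mor CC \<and> src CC s = \<Gamma> \<and> tgt CC s = X \<and> s \<cdot> pr CC X = idm CC \<Gamma>"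
  using fam1D[OF assms] fam_over[OF fam_pt, of X] len_pt
  by (auto simp: bd_fiber_def Obt_def sec_def hom_def strictly_over_def)

lemma Obt_psh_iff:
  "\<Gamma> \<in> Ob CC \<Longrightarrow> s \<in> sect (Obt_psh CC (Suc n)) \<Gamma> \<longleftrightarrow> fam (Suc n) (tgt CC s) \<Gamma> \<and> s \<in> bd_fiber CC (tgt CC s)"
  using fam_over[OF fam_pt, of "tgt CC s"] len_pt fam_over[of "Suc n" "tgt CC s" \<Gamma>]
  by (auto simp: bd_fiber_def Obt_def Obt_psh_def strictly_over_def fam_def) (auto simp: Ob_psh_def)

lemma section_mor_over1: "fam 1 X \<Gamma> \<Longrightarrow> s \<in> bd_fiber CC X \<Longrightarrow> mor_over CC \<Gamma> s"
  using fam1D[of X \<Gamma>] by (simp add: bd_fiber_iff mor_over_iff)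

lemma section_mor_over: "fam (Suc n) X \<Gamma> \<Longrightarrow> s \<in> bd_fiber CC X \<Longrightarrow> mor_over CC \<Gamma> s"
  by (metis fam_Suc_iff section_mor_over1 mor_over_trans fam_over)

lemma pull_section1:
  assumes "f \<in> Mor CC" "fam 1 X (tgt CC f)" "s \<in> bd_fiber CC X"
  shows "pull_mor CC f s \<in> bd_fiber CC (pull CC f X) \<and> pull_mor CC f s \<cdot> q CC f X = f \<cdot> s"
proof -
  have s: "s \<in> Mor CC" "src CC s = tgt CC f" "tgt CC s = X" "s \<cdot> pr CC X = idm CC (tgt CC f)"
    using assms bd_fiber_iff by auto
  have mo: "mor_over CC (tgt CC f) s" using section_mor_over1 assms by auto
  have fX: "fam 1 (pull CC f X) (src CC f)" using assms fam1_pull by auto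
  have "mor_over CC (src CC f) (pull_mor CC f s)" using assms mo by simp
  then have "pull_mor CC f s \<cdot> pr CC (pull CC f X) = idm CC (src CC f)"
    using s assms mo fam1D[OF fX] by (simp add: mor_over_iff)
  then show ?thesis using s assms mo pull_mor_square[OF assms(1) mo] by (simp add: bd_fiber_iff[OF fX])
qed

text \<open>A section of \<open>f\<^sup>*(X)\<close> is determined by its component in \<open>X\<close>.\<close>

lemma pull_section1_eqI:
  assumes "f \<in> Mor CC" "fam 1 X (tgt CC f)" "s \<in> bd_fiber CC X"
    and "t \<in> bd_fiber CC (pull CC f X)" "t \<cdot> q CC f X = f \<cdot> s"
  shows "pull_mor CC f s = t"
proof -
  note iff = bd_fiber_iff[OF fam1_pull[OF assms(1,2) refl]]
  note u = pull_section1[OF assms(1-3)]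
  show ?thesis
    by (rule pr_cancel[OF assms(1,2)])
      (use u[THEN conjunct1, unfolded iff] u[THEN conjunct2] assms(4)[unfolded iff] assms(5) in simp_all)
qed

lemma pull_section:
  assumes "f \<in> Mor CC" "fam (Suc n) X (tgt CC f)" "s \<in> bd_fiber CC X"
  shows "pull_mor CC f s \<in> bd_fiber CC (pull CC f X)"
proof -
  have X: "fam 1 X (ft CC X)" "fam n (ft CC X) (tgt CC f)" using assms(2) fam_Suc_iff by blast+
  note ov = fam_over[OF X(1)] fam_over[OF X(2)]
  have "pull_mor CC (q CC f (ft CC X)) s \<in> bd_fiber CC (pull CC (q CC f (ft CC X)) X)"
    using pull_section1[of "q CC f (ft CC X)" X s] X assms(1,3) ov by simp
  then show ?thesis
    using pull_mor_tower[of f "ft CC X" s] pull_tower[of f "ft CC X" X] section_mor_over1[OF X(1)] assms ov by simp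
qed

section \<open>Fiber products, exchange and diagonal\<close>

lemma fprod_eq: "fam 1 X \<Gamma> \<Longrightarrow> fprod CC \<Gamma> X Y = pull CC (pr CC X) Y"
  using fam1D by (simp add: fprod_def)

lemma fam_pull_pr: "fam 1 A \<Gamma> \<Longrightarrow> fam n X \<Gamma> \<Longrightarrow> fam n (pull CC (pr CC A) X) A"
  using fam_pull[of "pr CC A" n X] fam1D by simp

lemma exch_ex1:
  assumes "fam 1 A \<Gamma>" "fam 1 P \<Gamma>"
  shows "\<exists>!e. e \<in> hom CC (fprod CC \<Gamma> A P) (fprod CC \<Gamma> P A) \<and>
     e \<cdot> q CC (proj CC P \<Gamma>) A = proj CC (fprod CC \<Gamma> A P) A \<and>
     e \<cdot> proj CC (fprod CC \<Gamma> P A) P = q CC (proj CC A \<Gamma>) P"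
proof -
  note AP = fam1D[OF assms(1)] fam1D[OF assms(2)]
  have 1: "fam 1 (pull CC (pr CC A) P) A" "fam 1 (pull CC (pr CC P) A) P" using fam_pull_pr assms by auto
  note f = fam1D[OF 1(1)] fam1D[OF 1(2)]
  have PA: "pr CC P \<in> Mor CC" "fam 1 A (tgt CC (pr CC P))" using AP assms by simp_all
  have sq: "q CC (pr CC A) P \<cdot> pr CC P = pr CC (pull CC (pr CC A) P) \<cdot> pr CC A"
    using pr_square[of "pr CC A" P] AP assms by simp
  obtain e where e: "e \<in> Mor CC" "src CC e = pull CC (pr CC A) P" "tgt CC e = pull CC (pr CC P) A"
    "e \<cdot> pr CC (pull CC (pr CC P) A) = q CC (pr CC A) P" "e \<cdot> q CC (pr CC P) A = pr CC (pull CC (pr CC A) P)"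
    by (rule pr_lift[OF PA, of "q CC (pr CC A) P" "pr CC (pull CC (pr CC A) P)"]) (use f AP sq in simp_all)
  show ?thesis
  proof (rule ex1I[of _ e])
    fix e' assume e': "e' \<in> hom CC (fprod CC \<Gamma> A P) (fprod CC \<Gamma> P A) \<and>
     e' \<cdot> q CC (proj CC P \<Gamma>) A = proj CC (fprod CC \<Gamma> A P) A \<and>
     e' \<cdot> proj CC (fprod CC \<Gamma> P A) P = q CC (proj CC A \<Gamma>) P"
    show "e' = e"
      by (rule pr_cancel[OF PA]) (use e e' AP f assms in \<open>simp_all add: hom_def fprod_eq\<close>)
  qed (use e AP f assms in \<open>simp add: hom_def fprod_eq\<close>)
qed

lemma exch:
  assumes "fam 1 A \<Gamma>" "fam 1 P \<Gamma>"
  shows "exch CC \<Gamma> A P \<in> Mor CC" "src CC (exch CC \<Gamma> A P) = pull CC (pr CC A) P"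
    "tgt CC (exch CC \<Gamma> A P) = pull CC (pr CC P) A"
    "exch CC \<Gamma> A P \<cdot> q CC (pr CC P) A = pr CC (pull CC (pr CC A) P)"
    "exch CC \<Gamma> A P \<cdot> pr CC (pull CC (pr CC P) A) = q CC (pr CC A) P"
  using theI'[OF exch_ex1[OF assms]] fam1D[OF assms(1)] fam1D[OF assms(2)]
    fam1D[OF fam_pull_pr[OF assms]] fam1D[OF fam_pull_pr[OF assms(2,1)]] assms
  unfolding exch_def[symmetric] by (simp_all add: hom_def fprod_eq)

lemma diagonal_ex1:
  assumes "fam 1 P \<Gamma>"
  shows "\<exists>!d. is_diagonal CC \<Gamma> P d"
proof -
  note P = fam1D[OF assms] and PP = fam1D[OF fam_pull_pr[OF assms assms]]
  have 1: "pr CC P \<in> Mor CC" "fam 1 P (tgt CC (pr CC P))" using P assms by simp_all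
  obtain d where d: "d \<in> Mor CC" "src CC d = P" "tgt CC d = pull CC (pr CC P) P"
    "d \<cdot> pr CC (pull CC (pr CC P) P) = idm CC P" "d \<cdot> q CC (pr CC P) P = idm CC P"
    by (rule pr_lift[OF 1, of "idm CC P" "idm CC P"]) (use P in simp_all)
  show ?thesis
  proof (rule ex1I[of _ d])
    fix d' assume d': "is_diagonal CC \<Gamma> P d'"
    show "d' = d"
      by (rule pr_cancel[OF 1]) (use d d' assms in \<open>simp_all add: is_diagonal_def hom_def fprod_eq\<close>)
  qed (use d assms in \<open>simp add: is_diagonal_def hom_def fprod_eq\<close>)
qed

lemma diagonal:
  assumes "fam 1 P \<Gamma>"
  shows "diagonal CC \<Gamma> P \<in> bd_fiber CC (pull CC (pr CC P) P)"
    and "diagonal CC \<Gamma> P \<cdot> q CC (pr CC P) P = idm CC P"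
  using theI'[OF diagonal_ex1[OF assms]] bd_fiber_iff[OF fam_pull_pr[OF assms assms]] assms
  unfolding diagonal_def[symmetric] by (simp_all add: is_diagonal_def hom_def fprod_eq)

text \<open>The diagonal is the generic section of \<open>P\<close>. Since \<open>s \<cdot> p\<^sub>P = Id\<close>, base change along \<open>s\<close> brings
  \<open>p\<^sub>P\<^sup>*(P)\<close> back to \<open>P\<close>, and the component of \<open>s\<^sup>*(\<delta>)\<close> in \<open>P\<close> is \<open>s \<cdot> \<delta> \<cdot> q(p\<^sub>P, P) = s\<close>.\<close>

lemma pull_diagonal_section:
  assumes P: "fam 1 P \<Gamma>" and s: "s \<in> bd_fiber CC P"
  shows "pull CC s (pull CC (pr CC P) P) = P" "pull_mor CC s (diagonal CC \<Gamma> P) = s"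
proof -
  note P' = fam1D[OF P] and d = diagonal[OF P] and s' = s[unfolded bd_fiber_iff[OF P]]
  note PP = fam_pull_pr[OF P P]
  have sp: "s \<in> Mor CC" "fam 1 (pull CC (pr CC P) P) (tgt CC s)" "over CC (pull CC (pr CC P) P) (tgt CC s)"
    using s' PP fam1D by auto
  show 1: "pull CC s (pull CC (pr CC P) P) = P"
    using pull_cmp[of "pr CC P" s P] s' P' by (simp add: pull_id)
  show "pull_mor CC s (diagonal CC \<Gamma> P) = s"
  proof (rule pull_section1_eqI[OF sp(1,2) d(1)])
    show "s \<in> bd_fiber CC (pull CC s (pull CC (pr CC P) P))" using 1 s by simp
    have 2: "q CC s (pull CC (pr CC P) P) \<cdot> q CC (pr CC P) P = idm CC P"
      using q_cmp[of "pr CC P" s P] s' P' by (simp add: q_id)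
    have d': "diagonal CC \<Gamma> P \<in> Mor CC" "src CC (diagonal CC \<Gamma> P) = P"
       "tgt CC (diagonal CC \<Gamma> P) = pull CC (pr CC P) P" "diagonal CC \<Gamma> P \<cdot> pr CC (pull CC (pr CC P) P) = idm CC P"
      using d(1) bd_fiber_iff[OF PP] by auto
    have 3: "q CC s (pull CC (pr CC P) P) \<cdot> pr CC (pull CC (pr CC P) P) = pr CC P \<cdot> s"
      using pr_square[OF sp(1,2)] 1 by simp
    show "s \<cdot> q CC s (pull CC (pr CC P) P) = s \<cdot> diagonal CC \<Gamma> P"
    proof (rule pr_cancel[of "pr CC P" P])
      have "s \<cdot> (pr CC P \<cdot> s) = s" using s' P' by (simp flip: assoc)
      then show "s \<cdot> q CC s (pull CC (pr CC P) P) \<cdot> pr CC (pull CC (pr CC P) P) = s \<cdot> diagonal CC \<Gamma> P \<cdot> pr CC (pull CC (pr CC P) P)"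
        using s' P' sp d' 1 3 fam1D[OF PP] by (simp add: assoc)
    qed (use s' P' P sp d' d(2) 1 2 in \<open>simp_all add: assoc\<close>)
  qed
qed

text \<open>Both sides are base change of \<open>X\<close> along the two composites of the commutative square
  \<open>q(f, A) \<cdot> p\<^sub>A = p \<cdot> f\<close>.\<close>

lemma base_change_pr:
  assumes f: "f \<in> Mor CC" and A: "fam 1 A (tgt CC f)" and X: "over CC X (tgt CC f)"
  shows "pull CC (q CC f A) (pull CC (pr CC A) X) = pull CC (pr CC (pull CC f A)) (pull CC f X)"
    and "q CC (q CC f A) (pull CC (pr CC A) X) \<cdot> q CC (pr CC A) X
      = q CC (pr CC (pull CC f A)) (pull CC f X) \<cdot> q CC f X"
proof -
  note A1 = fam1D[OF A] and A2 = fam1D[OF fam1_pull[OF f A refl]]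
  have sq: "q CC f A \<cdot> pr CC A = pr CC (pull CC f A) \<cdot> f" using pr_square[OF f A] .
  show "pull CC (q CC f A) (pull CC (pr CC A) X) = pull CC (pr CC (pull CC f A)) (pull CC f X)"
    using pull_cmp[of "pr CC A" "q CC f A" X] pull_cmp[of f "pr CC (pull CC f A)" X] f X A1 A2 sq by simp
  show "q CC (q CC f A) (pull CC (pr CC A) X) \<cdot> q CC (pr CC A) X
      = q CC (pr CC (pull CC f A)) (pull CC f X) \<cdot> q CC f X"
    using q_cmp[of "pr CC A" "q CC f A" X] q_cmp[of f "pr CC (pull CC f A)" X] f X A1 A2 sq by simp
qed

text \<open>The recursion for the base change of \<open>A \<times>\<^sub>\<Gamma> X\<close>, interrupted at \<open>A\<close>, is \<open>base_change_pr\<close>.\<close>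

lemma base_change_fprod:
  assumes f: "f \<in> Mor CC" and A: "fam 1 A (tgt CC f)" and X: "over CC X (tgt CC f)"
  shows "pull CC f (pull CC (pr CC A) X) = pull CC (pr CC (pull CC f A)) (pull CC f X)"
    and "q CC f (pull CC (pr CC A) X) \<cdot> q CC (pr CC A) X
      = q CC (pr CC (pull CC f A)) (pull CC f X) \<cdot> q CC f X"
proof -
  note A1 = fam1D[OF A]
  have "over CC (pull CC (pr CC A) X) A" using A1 X by simp
  then have 1: "pull CC (q CC f A) (pull CC (pr CC A) X) = pull CC f (pull CC (pr CC A) X)"
    "q CC (q CC f A) (pull CC (pr CC A) X) = q CC f (pull CC (pr CC A) X)"
    using base_change_tower[of f A "pull CC (pr CC A) X"] f A1 by auto
  show "pull CC f (pull CC (pr CC A) X) = pull CC (pr CC (pull CC f A)) (pull CC f X)"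
    and "q CC f (pull CC (pr CC A) X) \<cdot> q CC (pr CC A) X
      = q CC (pr CC (pull CC f A)) (pull CC f X) \<cdot> q CC f X"
    using base_change_pr[OF assms] 1 by simp_all
qed

lemma pr_square_fprod:
  assumes f: "f \<in> Mor CC" and A: "fam 1 A (tgt CC f)" and X: "fam 1 X (tgt CC f)"
  shows "q CC f (pull CC (pr CC A) X) \<cdot> pr CC (pull CC (pr CC A) X)
      = pr CC (pull CC (pr CC (pull CC f A)) (pull CC f X)) \<cdot> q CC f A"
proof -
  note A1 = fam1D[OF A] and X1 = fam1D[OF X] and AX = fam_pull_pr[OF A X]
  have "q CC (q CC f A) (pull CC (pr CC A) X) \<cdot> pr CC (pull CC (pr CC A) X)
     = pr CC (pull CC (q CC f A) (pull CC (pr CC A) X)) \<cdot> q CC f A"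
    using pr_square[of "q CC f A" "pull CC (pr CC A) X"] f A1 AX by simp
  then show ?thesis
    using base_change_tower[of f A "pull CC (pr CC A) X"] base_change_pr(1)[OF f A, of X] f A1 X1 fam1D[OF AX] by simp
qed

text \<open>Stability of the generic section: it is the only section of \<open>P \<times>\<^sub>\<Gamma> P\<close> with component \<open>Id\<close> in \<open>P\<close>, and
  base change along \<open>q(f, P)\<close> keeps this property.\<close>

lemma pull_diagonal:
  assumes f: "f \<in> Mor CC" and P: "fam 1 P (tgt CC f)"
  shows "pull_mor CC (q CC f P) (diagonal CC (tgt CC f) P) = diagonal CC (src CC f) (pull CC f P)"
proof -
  let ?P' = "pull CC f P" let ?d = "diagonal CC (tgt CC f) P" and ?d' = "diagonal CC (src CC f) ?P'"
  let ?PP = "pull CC (pr CC P) P" and ?PP' = "pull CC (pr CC ?P') ?P'"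
  have P': "fam 1 ?P' (src CC f)" using fam1_pull f P by simp
  have PP: "fam 1 ?PP P" and PP': "fam 1 ?PP' ?P'" using fam_pull_pr P P' by auto
  note P1 = fam1D[OF P] fam1D[OF P'] and PP1 = fam1D[OF PP] fam1D[OF PP']
  note d = diagonal[OF P, unfolded bd_fiber_iff[OF PP]] and d' = diagonal[OF P', unfolded bd_fiber_iff[OF PP']]
  have qf: "q CC f P \<in> Mor CC" "fam 1 ?PP (tgt CC (q CC f P))" "pull CC (q CC f P) ?PP = ?PP'"
    using f P1 PP base_change_pr(1)[OF f P, of P] by simp_all
  have q: "q CC (q CC f P) ?PP \<cdot> q CC (pr CC P) P = q CC (pr CC ?P') ?P' \<cdot> q CC f P"
    using base_change_pr(2)[OF f P, of P] P1 by simp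
  have r: "q CC (q CC f P) ?PP \<cdot> pr CC ?PP = pr CC ?PP' \<cdot> q CC f P"
    using pr_square[OF qf(1,2)] qf(3) by simp
  have ov: "over CC ?PP (tgt CC (q CC f P))" using f P1 PP1 by simp
  have "?d' \<cdot> q CC (q CC f P) ?PP = q CC f P \<cdot> ?d"
  proof (rule pr_cancel[of "pr CC P" P])
    show "?d' \<cdot> q CC (q CC f P) ?PP \<cdot> pr CC ?PP = q CC f P \<cdot> ?d \<cdot> pr CC ?PP"
      using r d d' ov f P1 PP1 qf
        cmp_cong_left[of ?d' "pr CC ?PP'" "idm CC ?P'" "q CC f P"] by (simp add: assoc)
    show "?d' \<cdot> q CC (q CC f P) ?PP \<cdot> q CC (pr CC P) P = q CC f P \<cdot> ?d \<cdot> q CC (pr CC P) P"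
      using q d d' ov f P1 PP1 qf
        cmp_cong_left[of ?d' "q CC (pr CC ?P') ?P'" "idm CC ?P'" "q CC f P"] by (simp add: assoc)
  qed (use d d' ov f P P1 PP1 qf in simp_all)
  then show ?thesis
    by (intro pull_section1_eqI[OF qf(1,2)]) (use diagonal(1)[OF P] diagonal(1)[OF P'] qf(3) in simp_all)
qed

lemma exch_natural:
  assumes f: "f \<in> Mor CC" and A: "fam 1 A (tgt CC f)" and P: "fam 1 P (tgt CC f)"
  shows "exch CC (src CC f) (pull CC f A) (pull CC f P) \<cdot> q CC f (pull CC (pr CC P) A)
    = q CC f (pull CC (pr CC A) P) \<cdot> exch CC (tgt CC f) A P"
proof -
  let ?A' = "pull CC f A" and ?P' = "pull CC f P"
  have A': "fam 1 ?A' (src CC f)" and P': "fam 1 ?P' (src CC f)" using fam1_pull f A P by auto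
  let ?AP = "pull CC (pr CC A) P" and ?PA = "pull CC (pr CC P) A"
  let ?AP' = "pull CC (pr CC ?A') ?P'" and ?PA' = "pull CC (pr CC ?P') ?A'"
  have fams: "fam 1 ?AP A" "fam 1 ?PA P" "fam 1 ?AP' ?A'" "fam 1 ?PA' ?P'" using fam_pull_pr A P A' P' by auto
  note o1 = fam1D[OF A] fam1D[OF A'] fam1D[OF P] fam1D[OF P']
  note o2 = fams[THEN fam1D]
  have ov: "over CC ?AP (tgt CC f)" "over CC ?PA (tgt CC f)" using o1 o2 over_trans by blast+
  note e = exch[OF A P] and e' = exch[OF A' P']
  have p: "pull CC f ?AP = ?AP'" "pull CC f ?PA = ?PA'"
    using base_change_fprod(1)[OF f A, of P] base_change_fprod(1)[OF f P, of A] o1 by auto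
  have 1: "exch CC (src CC f) ?A' ?P' \<cdot> q CC f ?PA \<cdot> pr CC ?PA = q CC f ?AP \<cdot> exch CC (tgt CC f) A P \<cdot> pr CC ?PA"
  proof -
    have "exch CC (src CC f) ?A' ?P' \<cdot> q CC f ?PA \<cdot> pr CC ?PA = (exch CC (src CC f) ?A' ?P' \<cdot> pr CC ?PA') \<cdot> q CC f P"
      using e'(1-3) f ov o1 o2 p pr_square_fprod[OF f P A] by (simp add: assoc)
    also have "\<dots> = q CC f ?AP \<cdot> q CC (pr CC A) P"
      using e' base_change_fprod(2)[OF f A, of P] o1 by simp
    also have "\<dots> = q CC f ?AP \<cdot> exch CC (tgt CC f) A P \<cdot> pr CC ?PA"
      using e f ov o1 o2 p by (simp add: assoc)
    finally show ?thesis .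
  qed
  have 2: "exch CC (src CC f) ?A' ?P' \<cdot> q CC f ?PA \<cdot> q CC (pr CC P) A = q CC f ?AP \<cdot> exch CC (tgt CC f) A P \<cdot> q CC (pr CC P) A"
  proof -
    have "exch CC (src CC f) ?A' ?P' \<cdot> q CC f ?PA \<cdot> q CC (pr CC P) A = (exch CC (src CC f) ?A' ?P' \<cdot> q CC (pr CC ?P') ?A') \<cdot> q CC f A"
      using e'(1-3) f ov o1 o2 p base_change_fprod(2)[OF f P, of A] by (simp add: assoc)
    also have "\<dots> = q CC f ?AP \<cdot> pr CC ?AP"
      using e' pr_square_fprod[OF f A P] o1 by simp
    also have "\<dots> = q CC f ?AP \<cdot> exch CC (tgt CC f) A P \<cdot> q CC (pr CC P) A"
      using e f ov o1 o2 p by (simp add: assoc)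
    finally show ?thesis .
  qed
  show ?thesis
    by (rule pr_cancel[of "pr CC P" A]) (use 1 2 e e' f ov o1 o2 p A in simp_all)
qed

text \<open>Both morphisms \<open>A \<rightarrow> P \<times>\<^sub>\<Gamma> A\<close> are the graph of the composite \<open>A \<rightarrow> \<Gamma> \<rightarrow> P\<close>.\<close>

lemma section_exch:
  assumes A: "fam 1 A \<Gamma>" and P: "fam 1 P \<Gamma>" and s: "s \<in> bd_fiber CC P"
  shows "pull_mor CC (pr CC A) s \<cdot> exch CC \<Gamma> A P = q CC s (pull CC (pr CC P) A)"
proof -
  let ?AP = "pull CC (pr CC A) P" and ?PA = "pull CC (pr CC P) A"
  have fams: "fam 1 ?AP A" "fam 1 ?PA P" using fam_pull_pr A P by auto
  note o1 = fam1D[OF A] fam1D[OF P] fams[THEN fam1D] and e = exch[OF A P]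
  note s' = s[unfolded bd_fiber_iff[OF P]]
  have t: "pull_mor CC (pr CC A) s \<in> bd_fiber CC ?AP" "pull_mor CC (pr CC A) s \<cdot> q CC (pr CC A) P = pr CC A \<cdot> s"
    using pull_section1[of "pr CC A" P s] o1 P s by simp_all
  note t' = t(1)[unfolded bd_fiber_iff[OF fams(1)]]
  have p: "pull CC s ?PA = A" "q CC s ?PA \<cdot> q CC (pr CC P) A = idm CC A"
    using base_change_cmp[of "pr CC P" s A] s' o1 by (simp_all add: base_change_id)
  have r: "q CC s ?PA \<cdot> pr CC ?PA = pr CC A \<cdot> s"
    using pr_square[of s ?PA] s' fams p by simp
  show ?thesis
    by (rule pr_cancel[of "pr CC P" A]) (use t(2) t' s' e p r o1 A in \<open>simp_all add: assoc\<close>)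
qed

text \<open>In terms of generalised elements, \<open>(a, u) \<mapsto> (u, a) \<mapsto> (u, a, u) \<mapsto> (a, u)\<close>: the weakened diagonal
  doubles the variable in \<open>P\<close>, and the projection \<open>q(p\<^sub>P, A \<times>\<^sub>\<Gamma> P)\<close> forgets its original copy. This is the
  triangle identity behind \<open>application_of_evaluate\<close>.\<close>

lemma exch_pull_diagonal:
  assumes A: "fam 1 A \<Gamma>" and P: "fam 1 P \<Gamma>"
  shows "exch CC \<Gamma> A P \<cdot> (pull_mor CC (pr CC (pull CC (pr CC P) A)) (diagonal CC \<Gamma> P)
    \<cdot> q CC (pr CC P) (pull CC (pr CC A) P)) = idm CC (pull CC (pr CC A) P)"
proof -
  let ?AP = "pull CC (pr CC A) P" and ?PA = "pull CC (pr CC P) A" and ?PP = "pull CC (pr CC P) P"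
  have fams: "fam 1 ?AP A" "fam 1 ?PA P" "fam 1 ?PP P" using fam_pull_pr A P by auto
  note o1 = fam1D[OF A] fam1D[OF P] fams[THEN fam1D] and e = exch[OF A P]
  have p: "pr CC P \<in> Mor CC" "fam 1 A (tgt CC (pr CC P))" "fam 1 P (tgt CC (pr CC P))" using o1 A P by simp_all
  note d = diagonal[OF P]
  note d' = d(1)[unfolded bd_fiber_iff[OF fams(3)]]
  let ?t = "pull_mor CC (pr CC ?PA) (diagonal CC \<Gamma> P)"
  have t: "?t \<in> bd_fiber CC (pull CC (pr CC ?PA) ?PP)" "?t \<cdot> q CC (pr CC ?PA) ?PP = pr CC ?PA \<cdot> diagonal CC \<Gamma> P"
    using pull_section1[of "pr CC ?PA" ?PP] o1 fams d by simp_all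
  have fam3: "fam 1 (pull CC (pr CC ?PA) ?PP) ?PA" using fam_pull_pr fams by auto
  have t': "?t \<in> Mor CC" "src CC ?t = ?PA" "tgt CC ?t = pull CC (pr CC ?PA) ?PP"
    "?t \<cdot> pr CC (pull CC (pr CC ?PA) ?PP) = idm CC ?PA"
    using t(1) bd_fiber_iff[OF fam3] by simp_all
  have pp: "pull CC (pr CC P) ?AP = pull CC (pr CC ?PA) ?PP"
     "q CC (pr CC P) ?AP \<cdot> q CC (pr CC A) P = q CC (pr CC ?PA) ?PP \<cdot> q CC (pr CC P) P"
    using base_change_fprod[OF p(1,2), of P] o1 by simp_all
  have pr: "q CC (pr CC P) ?AP \<cdot> pr CC ?AP = pr CC (pull CC (pr CC ?PA) ?PP) \<cdot> q CC (pr CC P) A"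
    using pr_square_fprod[OF p] .
  have ov: "over CC ?AP \<Gamma>" using o1 over_trans by blast
  note o3 = fam1D[OF fam3]
  show ?thesis
  proof (rule pr_cancel[of "pr CC A" P])
    have "exch CC \<Gamma> A P \<cdot> (?t \<cdot> q CC (pr CC P) ?AP) \<cdot> pr CC ?AP
       = exch CC \<Gamma> A P \<cdot> ((?t \<cdot> pr CC (pull CC (pr CC ?PA) ?PP)) \<cdot> q CC (pr CC P) A)"
      using e(1-3) t'(1-3) pp pr ov o1 o3 by (simp add: assoc)
    also have "\<dots> = pr CC ?AP" using e t' o1 by simp
    finally show "exch CC \<Gamma> A P \<cdot> (?t \<cdot> q CC (pr CC P) ?AP) \<cdot> pr CC ?AP = idm CC ?AP \<cdot> pr CC ?AP"
      using o1 by simp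
    have "exch CC \<Gamma> A P \<cdot> (?t \<cdot> q CC (pr CC P) ?AP) \<cdot> q CC (pr CC A) P
       = exch CC \<Gamma> A P \<cdot> ((?t \<cdot> q CC (pr CC ?PA) ?PP) \<cdot> q CC (pr CC P) P)"
      using e(1-3) t' pp ov o1 o3 by (simp add: assoc)
    also have "\<dots> = exch CC \<Gamma> A P \<cdot> (pr CC ?PA \<cdot> (diagonal CC \<Gamma> P \<cdot> q CC (pr CC P) P))"
      unfolding t(2) using d' o1 by (simp add: assoc)
    also have "\<dots> = q CC (pr CC A) P" using e d o1 by simp
    finally show "exch CC \<Gamma> A P \<cdot> (?t \<cdot> q CC (pr CC P) ?AP) \<cdot> q CC (pr CC A) P = idm CC ?AP \<cdot> q CC (pr CC A) P"
      using o1 by simp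
  qed (use e t' pp ov o1 o3 P in simp_all)
qed

section \<open>Natural maps of sections and application morphisms\<close>

text \<open>Condition (c) on a Cartmell-Streicher structure is that this map is bijective on sections.\<close>

definition evaluate :: "('o \<Rightarrow> 'm) \<Rightarrow> 'o \<Rightarrow> 'm \<Rightarrow> 'm" where
  "evaluate Ap B s = pull_mor CC (pr CC (ft CC B)) s \<cdot> Ap B"

text \<open>The morphism representing \<open>\<phi>\<close>: its value at the generic section of \<open>P(B)\<close>, freed of the context \<open>P(B)\<close>.\<close>

definition application_of :: "('o \<Rightarrow> 'o) \<Rightarrow> ('o \<Rightarrow> 'm \<Rightarrow> 'm) \<Rightarrow> 'o \<Rightarrow> 'm" where
  "application_of P \<phi> B = exch CC (ft CC (ft CC B)) (ft CC B) (P B)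
     \<cdot> \<phi> (pull CC (pr CC (P B)) B) (diagonal CC (ft CC (ft CC B)) (P B)) \<cdot> q CC (pr CC (P B)) B"

definition stable_family :: "('o \<Rightarrow> 'o) \<Rightarrow> bool" where
  "stable_family P \<longleftrightarrow>
     (\<forall>B \<Gamma>. fam 2 B \<Gamma> \<longrightarrow> fam 1 (P B) \<Gamma>) \<and>
     (\<forall>B f. f \<in> Mor CC \<longrightarrow> fam 2 B (tgt CC f) \<longrightarrow> pull CC f (P B) = P (pull CC f B))"

definition stable_application :: "('o \<Rightarrow> 'o) \<Rightarrow> ('o \<Rightarrow> 'm) \<Rightarrow> bool" where
  "stable_application P Ap \<longleftrightarrow>
     (\<forall>B \<Gamma>. fam 2 B \<Gamma> \<longrightarrow> Ap B \<in> Mor CC \<and> src CC (Ap B) = pull CC (pr CC (ft CC B)) (P B) \<and>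
        tgt CC (Ap B) = B \<and> Ap B \<cdot> pr CC B = pr CC (pull CC (pr CC (ft CC B)) (P B))) \<and>
     (\<forall>B f. f \<in> Mor CC \<longrightarrow> fam 2 B (tgt CC f) \<longrightarrow> pull_mor CC f (Ap B) = Ap (pull CC f B))"

text \<open>The maps go in the direction of \<open>\<lambda>\<^sup>-\<^sup>1\<close>, as evaluation does.\<close>

definition natural_map :: "('o \<Rightarrow> 'o) \<Rightarrow> ('o \<Rightarrow> 'm \<Rightarrow> 'm) \<Rightarrow> bool" where
  "natural_map P \<phi> \<longleftrightarrow>
     (\<forall>B \<Gamma> s. fam 2 B \<Gamma> \<longrightarrow> s \<in> bd_fiber CC (P B) \<longrightarrow> \<phi> B s \<in> bd_fiber CC B) \<and>
     (\<forall>B f s. f \<in> Mor CC \<longrightarrow> fam 2 B (tgt CC f) \<longrightarrow> s \<in> bd_fiber CC (P B) \<longrightarrow>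
        pull_mor CC f (\<phi> B s) = \<phi> (pull CC f B) (pull_mor CC f s))"

lemma fam2D:
  assumes "fam 2 B \<Gamma>"
  shows "fam 1 B (ft CC B)" "fam 1 (ft CC B) \<Gamma>" "over CC B \<Gamma>" "ft CC (ft CC B) = \<Gamma>"
  using assms fam2_iff[of B \<Gamma>] fam_over[OF assms] fam1D by blast+

lemma fam2_pull:
  assumes "f \<in> Mor CC" "fam 2 B (tgt CC f)" "src CC f = \<Gamma>'"
  shows "fam 2 (pull CC f B) \<Gamma>'" "ft CC (pull CC f B) = pull CC f (ft CC B)"
  using fam_pull[OF assms(1,2)] ft_pull[OF assms(1), of 1 B] assms by (simp_all add: numeral_2_eq_2)

lemma pr_square2:
  assumes "f \<in> Mor CC" "fam 2 B (tgt CC f)"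
  shows "q CC f B \<cdot> pr CC B = pr CC (pull CC f B) \<cdot> q CC f (ft CC B)"
proof -
  note B = fam2D[OF assms(2)]
  show ?thesis
    using pr_square[of "q CC f (ft CC B)" B] base_change_tower[of f "ft CC B" B] assms B fam1D[OF B(1)] fam1D[OF B(2)] by simp
qed

lemma stable_application_mor_over:
  assumes P: "stable_family P" and Ap: "stable_application P Ap" and B: "fam 2 B \<Gamma>"
  shows "mor_over CC (ft CC B) (Ap B)"
proof -
  note fams = fam2D[OF B]
  have "fam 1 (P B) \<Gamma>" using P B unfolding stable_family_def by blast
  note fP = fam1D[OF fam_pull_pr[OF fams(2) this]]
  have "Ap B \<in> Mor CC \<and> src CC (Ap B) = pull CC (pr CC (ft CC B)) (P B) \<and>
        tgt CC (Ap B) = B \<and> Ap B \<cdot> pr CC B = pr CC (pull CC (pr CC (ft CC B)) (P B))"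
    using Ap B unfolding stable_application_def by blast
  then show ?thesis using fam1D[OF fams(1)] fP by (simp add: mor_over_iff)
qed

text \<open>Weakening a section to \<open>A\<close> and then changing base along \<open>q(f, A)\<close> is the same as changing base along \<open>f\<close>
  and then weakening to \<open>f\<^sup>*(A)\<close>, because \<open>q(f, A) \<cdot> p\<^sub>A = p \<cdot> f\<close>; composition with \<open>Ap\<close> is preserved since \<open>Ap\<close> is stable.\<close>

lemma evaluate_natural:
  assumes P: "stable_family P" and Ap: "stable_application P Ap"
  shows "natural_map P (evaluate Ap)"
  unfolding natural_map_def
proof (intro conjI allI impI)
  fix B \<Gamma> s assume B: "fam 2 B \<Gamma>" and s: "s \<in> bd_fiber CC (P B)"
  let ?A = "ft CC B"
  note fams = fam2D[OF B]
  note o1 = fam1D[OF fams(1)] fam1D[OF fams(2)]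
  have PB: "fam 1 (P B) \<Gamma>" using P B unfolding stable_family_def by blast
  note fP = fam_pull_pr[OF fams(2) PB]
  have Ap': "Ap B \<in> Mor CC \<and> src CC (Ap B) = pull CC (pr CC (ft CC B)) (P B) \<and>
        tgt CC (Ap B) = B \<and> Ap B \<cdot> pr CC B = pr CC (pull CC (pr CC (ft CC B)) (P B))"
    using Ap B unfolding stable_application_def by blast
  have "pull_mor CC (pr CC ?A) s \<in> bd_fiber CC (pull CC (pr CC ?A) (P B))"
    using pull_section1[of "pr CC ?A" "P B" s] o1 PB s by simp
  note t = this[unfolded bd_fiber_iff[OF fP]]
  show "evaluate Ap B s \<in> bd_fiber CC B"
    unfolding bd_fiber_iff[OF fams(1)] evaluate_def using t Ap' o1 by (simp add: assoc)
next
  fix B f s assume f: "f \<in> Mor CC" and B: "fam 2 B (tgt CC f)" and s: "s \<in> bd_fiber CC (P B)"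
  let ?A = "ft CC B"
  note fams = fam2D[OF B]
  note o1 = fam1D[OF fams(1)] fam1D[OF fams(2)]
  have PB: "fam 1 (P B) (tgt CC f)" using P B unfolding stable_family_def by blast
  note fP = fam_pull_pr[OF fams(2) PB]
  have Ap': "Ap B \<in> Mor CC \<and> src CC (Ap B) = pull CC (pr CC (ft CC B)) (P B) \<and>
        tgt CC (Ap B) = B \<and> Ap B \<cdot> pr CC B = pr CC (pull CC (pr CC (ft CC B)) (P B))"
     "pull_mor CC f (Ap B) = Ap (pull CC f B)"
    using Ap B f unfolding stable_application_def by blast+
  have "pull_mor CC (pr CC ?A) s \<in> bd_fiber CC (pull CC (pr CC ?A) (P B))"
    using pull_section1[of "pr CC ?A" "P B" s] o1 PB s by simp
  note t = this[unfolded bd_fiber_iff[OF fP]] and t_over = section_mor_over1[OF fP this]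
  have A_over: "over CC ?A (tgt CC f)" using o1 by blast
  have overs: "mor_over CC (tgt CC f) (pull_mor CC (pr CC ?A) s)" "mor_over CC (tgt CC f) (Ap B)"
    using mor_over_trans[OF t_over A_over] mor_over_trans[OF stable_application_mor_over[OF P Ap B] A_over] .
  note s_over = section_mor_over1[OF PB s]
  note A' = fam1D[OF fam1_pull[OF f fams(2) refl]]
  have "pull_mor CC f (pull_mor CC (pr CC ?A) s) = pull_mor CC (q CC f ?A \<cdot> pr CC ?A) s"
    using pull_mor_tower[OF f A_over t_over] pull_mor_comp_base[of "pr CC ?A" "q CC f ?A" s] o1 f s_over by simp
  also have "\<dots> = pull_mor CC (pr CC (pull CC f ?A)) (pull_mor CC f s)"
    using pull_mor_comp_base[of f "pr CC (pull CC f ?A)" s] pr_square[OF f fams(2)] f A' s_over by simp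
  finally show "pull_mor CC f (evaluate Ap B s) = evaluate Ap (pull CC f B) (pull_mor CC f s)"
    unfolding evaluate_def
    using pull_mor_cmp[OF f overs] t Ap' fam2_pull(2)[OF f B refl] by simp
qed

text \<open>Here \<open>B'\<close> is \<open>P \<times>\<^sub>\<Gamma> B\<close>, regarded over \<open>P = P(B)\<close>. Stability of the family makes the diagonal of \<open>P\<close> a section of
  \<open>P(B')\<close>, so that \<open>\<phi>\<close> applies to it.\<close>

lemma ap_section:
  assumes P: "stable_family P" and \<phi>: "natural_map P \<phi>" and B: "fam 2 B \<Gamma>"
  defines "B' \<equiv> pull CC (pr CC (P B)) B"
  shows "P B' = pull CC (pr CC (P B)) (P B)" "ft CC B' = pull CC (pr CC (P B)) (ft CC B)" "fam 2 B' (P B)"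
    "\<phi> B' (diagonal CC \<Gamma> (P B)) \<in> bd_fiber CC B'"
proof -
  have PB: "fam 1 (P B) \<Gamma>" using P B unfolding stable_family_def by blast
  then have p: "pr CC (P B) \<in> Mor CC" "src CC (pr CC (P B)) = P B" "tgt CC (pr CC (P B)) = \<Gamma>"
    using fam1D by simp_all
  show 1: "P B' = pull CC (pr CC (P B)) (P B)"
    using P p B unfolding stable_family_def B'_def by simp
  show "ft CC B' = pull CC (pr CC (P B)) (ft CC B)" "fam 2 B' (P B)"
    using fam2_pull[of "pr CC (P B)" B] p B unfolding B'_def by simp_all
  moreover have "diagonal CC \<Gamma> (P B) \<in> bd_fiber CC (P B')" using diagonal(1)[OF PB] 1 by simp
  ultimately show "\<phi> B' (diagonal CC \<Gamma> (P B)) \<in> bd_fiber CC B'"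
    using \<phi> unfolding natural_map_def by blast
qed

lemma application_of_typing:
  assumes P: "stable_family P" and \<phi>: "natural_map P \<phi>" and B: "fam 2 B \<Gamma>"
  shows "application_of P \<phi> B \<in> Mor CC" "src CC (application_of P \<phi> B) = pull CC (pr CC (ft CC B)) (P B)"
    "tgt CC (application_of P \<phi> B) = B" "application_of P \<phi> B \<cdot> pr CC B = pr CC (pull CC (pr CC (ft CC B)) (P B))"
proof -
  let ?A = "ft CC B" and ?B' = "pull CC (pr CC (P B)) B"
  note fams = fam2D[OF B] and B' = ap_section[OF assms]
  have PB: "fam 1 (P B) \<Gamma>" using P B unfolding stable_family_def by blast
  note o1 = fam1D[OF fams(1)] fam1D[OF fams(2)] fam1D[OF PB] and fams' = fam2D[OF B'(3)]
  note o2 = fam1D[OF fams'(1)] fam1D[OF fams'(2)]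
  note e = exch[OF fams(2) PB]
  have ap: "\<phi> ?B' (diagonal CC \<Gamma> (P B)) \<in> Mor CC" "src CC (\<phi> ?B' (diagonal CC \<Gamma> (P B))) = pull CC (pr CC (P B)) ?A"
    "tgt CC (\<phi> ?B' (diagonal CC \<Gamma> (P B))) = ?B'"
    "\<phi> ?B' (diagonal CC \<Gamma> (P B)) \<cdot> pr CC ?B' = idm CC (pull CC (pr CC (P B)) ?A)"
    using B'(4) B'(2) unfolding bd_fiber_iff[OF fams'(1)] by simp_all
  have sq: "q CC (pr CC (P B)) B \<cdot> pr CC B = pr CC ?B' \<cdot> q CC (pr CC (P B)) ?A"
    using pr_square2[of "pr CC (P B)" B] o1 B by simp
  show "application_of P \<phi> B \<in> Mor CC" "src CC (application_of P \<phi> B) = pull CC (pr CC (ft CC B)) (P B)"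
    "tgt CC (application_of P \<phi> B) = B"
    unfolding application_of_def using e ap o1 fams by simp_all
  have "application_of P \<phi> B \<cdot> pr CC B = exch CC \<Gamma> ?A (P B) \<cdot> ((\<phi> ?B' (diagonal CC \<Gamma> (P B)) \<cdot> pr CC ?B') \<cdot> q CC (pr CC (P B)) ?A)"
    unfolding application_of_def using e(1-3) ap(1-3) sq o1 o2 fams B'(2) by (simp add: assoc)
  also have "\<dots> = pr CC (pull CC (pr CC (ft CC B)) (P B))"
    using e ap o1 by simp
  finally show "application_of P \<phi> B \<cdot> pr CC B = pr CC (pull CC (pr CC (ft CC B)) (P B))" .
qed

text \<open>Each of the three factors of \<open>application_of\<close> is compatible with \<open>f\<close>: the exchange
  by uniqueness, the projection by functoriality of \<open>q\<close>, and \<open>\<phi>(\<delta>)\<close> because \<open>\<phi>\<close> is natural along \<open>q(f, P)\<close> and \<open>\<delta>\<close> is stable.\<close>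

lemma application_of_stable:
  assumes P: "stable_family P" and \<phi>: "natural_map P \<phi>"
  shows "stable_application P (application_of P \<phi>)"
  unfolding stable_application_def
proof (intro conjI allI impI)
  fix B f assume f: "f \<in> Mor CC" and B: "fam 2 B (tgt CC f)"
  let ?A = "ft CC B" and ?P = "P B" let ?B' = "pull CC (pr CC ?P) B"
  let ?Bf = "pull CC f B" let ?Af = "ft CC ?Bf" and ?Pf = "P ?Bf" let ?Bf' = "pull CC (pr CC ?Pf) ?Bf"
  let ?d = "diagonal CC (tgt CC f) ?P" and ?df = "diagonal CC (src CC f) ?Pf"
  let ?e = "exch CC (tgt CC f) ?A ?P" and ?ef = "exch CC (src CC f) ?Af ?Pf"
  have PB: "fam 1 ?P (tgt CC f)" "pull CC f ?P = ?Pf" using P B f unfolding stable_family_def by blast+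
  note Bf = fam2_pull[OF f B refl]
  have Af: "?Af = pull CC f ?A" by (rule Bf(2))
  have PBf: "fam 1 ?Pf (src CC f)" using P Bf unfolding stable_family_def by blast
  note fams = fam2D[OF B] and famsf = fam2D[OF Bf(1)]
  note t = application_of_typing[OF assms B] and tf = application_of_typing[OF assms Bf(1)]
  note B' = ap_section[OF assms B] and Bf' = ap_section[OF assms Bf(1)]
  note o1 = fam1D[OF fams(1)] fam1D[OF fams(2)] fam1D[OF PB(1)]
  note o1f = fam1D[OF famsf(1)] fam1D[OF famsf(2)] fam1D[OF PBf]
  note fams' = fam2D[OF B'(3)] and famsf' = fam2D[OF Bf'(3)]
  note e = exch[OF fams(2) PB(1)] and ef = exch[OF famsf(2) PBf]
  let ?AP = "pull CC (pr CC ?A) ?P" and ?PA = "pull CC (pr CC ?P) ?A"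
  have ov: "over CC ?AP (tgt CC f)" "over CC ?PA (tgt CC f)" "over CC ?B' (tgt CC f)" "over CC ?B' ?P"
    using fam_over[OF fam_trans[OF fam_pull_pr[OF fams(2) PB(1)] fams(2)]]
      fam_over[OF fam_trans[OF fam_pull_pr[OF PB(1) fams(2)] PB(1)]]
      fam_over[OF fam_trans[OF B'(3) PB(1)]] fam_over[OF B'(3)] by auto
  have ap: "\<phi> ?B' ?d \<in> Mor CC" "src CC (\<phi> ?B' ?d) = ?PA" "tgt CC (\<phi> ?B' ?d) = ?B'"
    using B'(2,4) unfolding bd_fiber_iff[OF fams'(1)] by simp_all
  have apf: "\<phi> ?Bf' ?df \<in> Mor CC" "src CC (\<phi> ?Bf' ?df) = pull CC (pr CC ?Pf) ?Af" "tgt CC (\<phi> ?Bf' ?df) = ?Bf'"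
    using Bf'(2,4) unfolding bd_fiber_iff[OF famsf'(1)] by simp_all
  have ap_over: "mor_over CC (tgt CC (q CC f ?P)) (\<phi> ?B' ?d)"
    using section_mor_over[of 1 ?B' ?P "\<phi> ?B' ?d"] B'(3,4) f o1 by (simp add: numeral_2_eq_2)
  have Bf'_eq: "pull CC (q CC f ?P) ?B' = ?Bf'" and qB': "q CC (q CC f ?P) ?B' \<cdot> q CC (pr CC ?P) B = q CC (pr CC ?Pf) ?Bf \<cdot> q CC f B"
    using base_change_pr[OF f PB(1), of B] fams(3) PB(2) by simp_all
  have qPA: "q CC (q CC f ?P) ?PA = q CC f ?PA" "pull CC (q CC f ?P) ?PA = pull CC f ?PA"
    using base_change_tower[of f ?P ?PA] f o1 fam1D[OF fam_pull_pr[OF PB(1) fams(2)]] by auto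
  have d: "?d \<in> bd_fiber CC (P ?B')" using diagonal(1)[OF PB(1)] B'(1) by simp
  have "pull_mor CC (q CC f ?P) (\<phi> ?B' ?d) = \<phi> ?Bf' ?df"
  proof -
    have "pull_mor CC (q CC f ?P) (\<phi> ?B' ?d) = \<phi> (pull CC (q CC f ?P) ?B') (pull_mor CC (q CC f ?P) ?d)"
      using \<phi> f o1 B'(3) d unfolding natural_map_def by simp
    then show ?thesis using Bf'_eq pull_diagonal[OF f PB(1)] PB(2) by simp
  qed
  then have ap_sq: "\<phi> ?Bf' ?df \<cdot> q CC (q CC f ?P) ?B' = q CC f ?PA \<cdot> \<phi> ?B' ?d"
    using pull_mor_square[OF _ ap_over] ap f o1 qPA by simp
  have e_sq: "?ef \<cdot> q CC f ?PA = q CC f ?AP \<cdot> ?e"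
    using exch_natural[OF f fams(2) PB(1)] Af PB(2) by simp
  have pAP: "pull CC f ?AP = pull CC (pr CC ?Af) ?Pf" "pull CC f ?PA = pull CC (pr CC ?Pf) ?Af"
    using base_change_fprod(1)[OF f fams(2), of ?P] base_change_fprod(1)[OF f PB(1), of ?A] o1 Af PB(2) by auto
  have tr: "application_of P \<phi> B = ?e \<cdot> (\<phi> ?B' ?d \<cdot> q CC (pr CC ?P) B)"
    unfolding application_of_def using fams o1 e(1-3) ap by (simp add: assoc)
  have trf: "application_of P \<phi> ?Bf = ?ef \<cdot> (\<phi> ?Bf' ?df \<cdot> q CC (pr CC ?Pf) ?Bf)"
    unfolding application_of_def using famsf o1f ef(1-3) apf by (simp add: assoc)
  \<comment> \<open>The three compatibilities \<open>qB'\<close>, \<open>ap_sq\<close> and \<open>e_sq\<close> move \<open>q(f, _)\<close> leftwards through the composite.\<close>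
  have "application_of P \<phi> ?Bf \<cdot> q CC f B = ?ef \<cdot> (\<phi> ?Bf' ?df \<cdot> (q CC (pr CC ?Pf) ?Bf \<cdot> q CC f B))"
    unfolding trf using famsf fams o1f f ef(1-3) apf by (simp add: assoc)
  also have "\<dots> = ?ef \<cdot> ((\<phi> ?Bf' ?df \<cdot> q CC (q CC f ?P) ?B') \<cdot> q CC (pr CC ?P) B)"
    unfolding qB'[symmetric] using fams f o1 ap apf Bf'_eq ov(4) by (simp add: assoc)
  also have "\<dots> = (?ef \<cdot> q CC f ?PA) \<cdot> (\<phi> ?B' ?d \<cdot> q CC (pr CC ?P) B)"
    unfolding ap_sq using fams f o1 ap apf ef(1-3) ov(2) pAP by (simp add: assoc)
  also have "\<dots> = q CC f ?AP \<cdot> application_of P \<phi> B"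
    unfolding e_sq tr using fams f o1 ap e(1-3) ov(1) pAP by (simp add: assoc)
  finally have sq: "application_of P \<phi> ?Bf \<cdot> q CC f B = q CC f ?AP \<cdot> application_of P \<phi> B" .
  have mo: "mor_over CC \<Gamma> (application_of P \<phi> X)" if X: "fam 2 X \<Gamma>" for X \<Gamma>
  proof (rule mor_over_trans)
    note fX = fam2D[OF X] and tX = application_of_typing[OF assms X]
    have "fam 1 (P X) \<Gamma>" using P X unfolding stable_family_def by blast
    from fam1D[OF fam_pull_pr[OF fX(2) this]]
    show "mor_over CC (ft CC X) (application_of P \<phi> X)" "over CC (ft CC X) \<Gamma>"
      using tX fam1D[OF fX(1)] fam1D[OF fX(2)] by (simp_all add: mor_over_iff)
  qed
  show "pull_mor CC f (application_of P \<phi> B) = application_of P \<phi> (pull CC f B)"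
    by (rule pull_mor_eqI) (use f mo[OF B] mo[OF Bf(1)] t tf pAP sq in simp_all)
qed (use application_of_typing[OF assms] in blast)+

text \<open>Half of the Yoneda lemma: \<open>\<phi>(s) = \<phi>(s\<^sup>*(\<delta>)) = s\<^sup>*(\<phi>(\<delta>))\<close>, by naturality along the section \<open>s\<close> itself.\<close>

lemma evaluate_application_of:
  assumes P: "stable_family P" and \<phi>: "natural_map P \<phi>" and B: "fam 2 B \<Gamma>" and s: "s \<in> bd_fiber CC (P B)"
  shows "evaluate (application_of P \<phi>) B s = \<phi> B s"
proof -
  let ?A = "ft CC B" and ?P = "P B" let ?B' = "pull CC (pr CC ?P) B"
  let ?d = "diagonal CC \<Gamma> ?P" and ?e = "exch CC \<Gamma> ?A ?P"
  let ?AP = "pull CC (pr CC ?A) ?P" and ?PA = "pull CC (pr CC ?P) ?A"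
  have PB: "fam 1 ?P \<Gamma>" using P B unfolding stable_family_def by blast+
  note fams = fam2D[OF B] and B' = ap_section[OF P \<phi> B]
  note o1 = fam1D[OF fams(1)] fam1D[OF fams(2)] fam1D[OF PB(1)]
  note fams' = fam2D[OF B'(3)] and e = exch[OF fams(2) PB(1)]
  note fAP = fam_pull_pr[OF fams(2) PB] and fPA = fam_pull_pr[OF PB fams(2)]
  note s' = s[unfolded bd_fiber_iff[OF PB]]
  have ap: "\<phi> ?B' ?d \<in> Mor CC" "src CC (\<phi> ?B' ?d) = ?PA" "tgt CC (\<phi> ?B' ?d) = ?B'"
    using B'(2,4) unfolding bd_fiber_iff[OF fams'(1)] by simp_all
  have ap_over: "mor_over CC (tgt CC s) (\<phi> ?B' ?d)"
    using section_mor_over[of 1 ?B' ?P "\<phi> ?B' ?d"] B'(3,4) s' by (simp add: numeral_2_eq_2)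
  have d: "?d \<in> bd_fiber CC (P ?B')" using diagonal(1)[OF PB(1)] B'(1) by simp
  have sB: "pull CC s ?B' = B" "q CC s ?B' \<cdot> q CC (pr CC ?P) B = idm CC B"
    using base_change_cmp[of "pr CC ?P" s B] s' o1 fams(3) by (simp_all add: base_change_id)
  have "pull_mor CC s (\<phi> ?B' ?d) = \<phi> (pull CC s ?B') (pull_mor CC s ?d)"
    using \<phi> s' o1 B'(3) d unfolding natural_map_def by simp
  then have "pull_mor CC s (\<phi> ?B' ?d) = \<phi> B s"
    using pull_diagonal_section(2)[OF PB s] sB(1) by simp
  then have ap_sq: "\<phi> B s \<cdot> q CC s ?B' = q CC s ?PA \<cdot> \<phi> ?B' ?d"
    using pull_mor_square[OF _ ap_over] ap s' by simp
  have "\<phi> B s \<in> bd_fiber CC B" using \<phi> B s unfolding natural_map_def by blast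
  then have \<phi>s: "\<phi> B s \<in> Mor CC" "tgt CC (\<phi> B s) = B" using bd_fiber_iff[OF fams(1)] by auto
  have "pull_mor CC (pr CC ?A) s \<in> bd_fiber CC ?AP"
    using pull_section1[of "pr CC ?A" ?P s] o1 PB s by simp
  note t = this[unfolded bd_fiber_iff[OF fAP]]
  have ov: "over CC ?B' ?P" "over CC ?PA ?P" using fam_over[OF B'(3)] fam_over[OF fPA] .
  have "evaluate (application_of P \<phi>) B s = (pull_mor CC (pr CC ?A) s \<cdot> ?e) \<cdot> (\<phi> ?B' ?d \<cdot> q CC (pr CC ?P) B)"
    unfolding evaluate_def application_of_def using t e(1-3) ap fams o1 by (simp add: assoc)
  also have "\<dots> = (q CC s ?PA \<cdot> \<phi> ?B' ?d) \<cdot> q CC (pr CC ?P) B"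
    unfolding section_exch[OF fams(2) PB s] using ap fams o1 s' ov by (simp add: assoc)
  also have "\<dots> = \<phi> B s \<cdot> (q CC s ?B' \<cdot> q CC (pr CC ?P) B)"
    unfolding ap_sq[symmetric] using ap fams o1 s' ov \<phi>s sB(1) by (simp add: assoc)
  also have "\<dots> = \<phi> B s" using sB \<phi>s by simp
  finally show ?thesis .
qed

text \<open>The other half: by stability, \<open>Ap\<close> at \<open>P \<times>\<^sub>\<Gamma> B\<close> is the base change of \<open>Ap\<^sub>B\<close> along \<open>p\<^sub>P\<close>, so projecting it to \<open>B\<close> gives
  \<open>Ap\<^sub>B\<close> preceded by a projection, and \<open>exch_pull_diagonal\<close> cancels everything in front.\<close>

lemma application_of_evaluate:
  assumes P: "stable_family P" and Ap: "stable_application P Ap" and B: "fam 2 B \<Gamma>"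
  shows "application_of P (evaluate Ap) B = Ap B"
proof -
  let ?A = "ft CC B" and ?P = "P B" let ?B' = "pull CC (pr CC ?P) B"
  let ?d = "diagonal CC \<Gamma> ?P" and ?e = "exch CC \<Gamma> ?A ?P"
  let ?AP = "pull CC (pr CC ?A) ?P" and ?PA = "pull CC (pr CC ?P) ?A"
  have PB: "fam 1 ?P \<Gamma>" using P B unfolding stable_family_def by blast+
  note fams = fam2D[OF B] and B' = ap_section[OF P evaluate_natural[OF P Ap] B]
  note o1 = fam1D[OF fams(1)] fam1D[OF fams(2)] fam1D[OF PB(1)]
  note fams' = fam2D[OF B'(3)] and e = exch[OF fams(2) PB(1)]
  note fAP = fam_pull_pr[OF fams(2) PB] and fPA = fam_pull_pr[OF PB fams(2)] and fPP = fam_pull_pr[OF PB PB]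
  note fPAPP = fam_pull_pr[OF fPA fPP]
  have "fam (1 + 1) ?AP \<Gamma>" using fam_trans[OF fAP fams(2)] .
  note ovAP = fam_over[OF this]
  have Ap': "Ap B \<in> Mor CC \<and> src CC (Ap B) = ?AP \<and> tgt CC (Ap B) = B"
    using Ap B unfolding stable_application_def by blast
  have Ap'': "Ap ?B' \<in> Mor CC \<and> src CC (Ap ?B') = pull CC (pr CC ?PA) (pull CC (pr CC ?P) ?P) \<and> tgt CC (Ap ?B') = ?B'"
    using Ap B'(1-3) unfolding stable_application_def by auto
  have ApB: "pull_mor CC (pr CC ?P) (Ap B) = Ap ?B'"
    using Ap B o1 unfolding stable_application_def by simp
  have mo: "mor_over CC (tgt CC (pr CC ?P)) (Ap B)"
    using mor_over_trans[OF stable_application_mor_over[OF P Ap B]] o1 by simp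
  \<comment> \<open>The defining square of the base change of \<open>Ap\<^sub>B\<close> along \<open>p\<^sub>P\<close>.\<close>
  have sq: "Ap ?B' \<cdot> q CC (pr CC ?P) B = q CC (pr CC ?P) ?AP \<cdot> Ap B"
    using pull_mor_square[OF _ mo] ApB Ap' o1 by simp
  have "pull_mor CC (pr CC ?PA) ?d \<in> bd_fiber CC (pull CC (pr CC ?PA) (pull CC (pr CC ?P) ?P))"
    using pull_section1[of "pr CC ?PA" "pull CC (pr CC ?P) ?P" ?d] fam1D[OF fPA] fam1D[OF fPP] fPP diagonal(1)[OF PB] by simp
  note t = this[unfolded bd_fiber_iff[OF fPAPP]]
  have pp: "pull CC (pr CC ?P) ?AP = pull CC (pr CC ?PA) (pull CC (pr CC ?P) ?P)"
    using base_change_fprod(1)[of "pr CC ?P" ?A ?P] fams(2) o1 by simp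
  have "application_of P (evaluate Ap) B = (?e \<cdot> (pull_mor CC (pr CC ?PA) ?d \<cdot> Ap ?B')) \<cdot> q CC (pr CC ?P) B"
    unfolding application_of_def evaluate_def using fams(4) B'(2) by simp
  also have "\<dots> = ?e \<cdot> (pull_mor CC (pr CC ?PA) ?d \<cdot> (Ap ?B' \<cdot> q CC (pr CC ?P) B))"
    using t e(1-3) Ap'' fams o1 by (simp add: assoc)
  also have "\<dots> = (?e \<cdot> (pull_mor CC (pr CC ?PA) ?d \<cdot> q CC (pr CC ?P) ?AP)) \<cdot> Ap B"
    unfolding sq using t e(1-3) Ap' fams o1 ovAP pp by (simp add: assoc)
  also have "\<dots> = Ap B" unfolding exch_pull_diagonal[OF fams(2) PB] using Ap' by simp
  finally show ?thesis .
qed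

section \<open>Cartmell-Streicher structures as stable application morphisms\<close>

lemma Ob_ge2_iff: "B \<in> Ob_ge2 CC \<longleftrightarrow> fam 2 B (ft CC (ft CC B))"
proof -
  have "fam 2 B (ft CC (ft CC B)) \<longleftrightarrow> B \<in> Ob CC \<and> 0 < len CC B \<and> 0 < len CC (ft CC B)"
    unfolding numeral_2_eq_2 fam_Suc fam_0 using ft_in by blast
  then show ?thesis using len_ft[of B] by (auto simp: Ob_ge2_def)
qed

lemma fam2_Ob_ge2: "fam 2 B \<Gamma> \<Longrightarrow> B \<in> Ob_ge2 CC"
  using fam2D(4) Ob_ge2_iff by metis

lemma stable_application_cong:
  assumes "\<And>B. B \<in> Ob_ge2 CC \<Longrightarrow> Ap B = Ap' B" "stable_application P Ap"
  shows "stable_application P Ap'"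
proof -
  have "Ap' B = Ap B" "f \<in> Mor CC \<Longrightarrow> fam 2 B (tgt CC f) \<Longrightarrow> Ap' (pull CC f B) = Ap (pull CC f B)" if "fam 2 B \<Gamma>" for f B \<Gamma>
    using assms(1) that fam2_Ob_ge2 fam2_pull(1) by metis+
  then show ?thesis using assms(2) unfolding stable_application_def by metis
qed

text \<open>If \<open>\<Pi>(B)\<close> were \<open>pt\<close>, then \<open>\<Gamma> = pt\<close> and \<open>f\<^sup>*(\<Pi>(B))\<close> would be the source of \<open>f\<close>, for every \<open>f\<close> into \<open>pt\<close>.
  Taking \<open>f : B \<rightarrow> pt\<close>, stability gives \<open>B = \<Pi>(f\<^sup>*(B))\<close>, whence \<open>ft(B) = B\<close>, which contradicts the lengths.\<close>

lemma CS_structure_positive: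
  assumes P: "PI \<in> Ob_ge2 CC \<rightarrow> Ob CC"
    and ft: "\<And>B. B \<in> Ob_ge2 CC \<Longrightarrow> ft CC (PI B) = ft CC (ft CC B)"
    and stable: "\<And>B f. B \<in> Ob_ge2 CC \<Longrightarrow> f \<in> Mor CC \<Longrightarrow> tgt CC f = ft CC (ft CC B) \<Longrightarrow> pull CC f (PI B) = PI (pull CC f B)"
    and B: "B \<in> Ob_ge2 CC"
  shows "0 < len CC (PI B)"
proof (rule ccontr)
  assume "\<not> 0 < len CC (PI B)"
  then have pt: "PI B = pt CC" using P B len_0 by auto
  then have \<Gamma>: "ft CC (ft CC B) = pt CC" using ft[OF B] ft_pt by simp
  have Bo: "B \<in> Ob CC" "len CC B \<ge> 2" using B by (auto simp: Ob_ge2_def)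
  then obtain f where "f \<in> hom CC B (pt CC)" using pt_final unfolding final_object_def by blast
  then have f: "f \<in> Mor CC" "src CC f = B" "tgt CC f = pt CC" by (auto simp: hom_def)
  have fB: "fam 2 (pull CC f B) B" using fam2_pull(1)[of f B B] f B \<Gamma> by (simp add: Ob_ge2_iff)
  have "B = PI (pull CC f B)" using stable[OF B f(1)] f \<Gamma> pt by simp
  moreover have "ft CC (PI (pull CC f B)) = B" using ft[OF fam2_Ob_ge2[OF fB]] fam2D(4)[OF fB] by simp
  ultimately have "ft CC B = B" by simp
  then show False using len_ft[OF Bo(1)] Bo(2) by simp
qed

lemma CS_structures_iff:
  "(PI, Ap) \<in> CS_structures CC \<longleftrightarrow>
     PI \<in> extensional (Ob_ge2 CC) \<and> Ap \<in> extensional (Ob_ge2 CC) \<and>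
     stable_family PI \<and> stable_application PI Ap \<and>
     (\<forall>B\<in>Ob_ge2 CC. bij_betw (evaluate Ap B) (bd_fiber CC (PI B)) (bd_fiber CC B))" (is "?L \<longleftrightarrow> ?R")
proof
  assume L: ?L
  then have ext: "PI \<in> extensional (Ob_ge2 CC)" "Ap \<in> extensional (Ob_ge2 CC)"
    and PO: "PI \<in> Ob_ge2 CC \<rightarrow> Ob CC" and AM: "Ap \<in> Ob_ge2 CC \<rightarrow> Mor CC"
    unfolding CS_structures_def by (auto simp: PiE_def)
  have *: "ft CC (PI B) = ft CC (ft CC B) \<and>
     (\<forall>\<Gamma>'\<in>Ob CC. \<forall>f\<in>hom CC \<Gamma>' (ft CC (ft CC B)). pull CC f (PI B) = PI (pull CC f B)) \<and>
     Ap B \<in> hom CC (fprod CC (ft CC (ft CC B)) (ft CC B) (PI B)) B \<and> mor_over CC (ft CC B) (Ap B) \<and>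
     (\<forall>\<Gamma>'\<in>Ob CC. \<forall>f\<in>hom CC \<Gamma>' (ft CC (ft CC B)). pull_mor CC f (Ap B) = Ap (pull CC f B)) \<and>
     bij_betw (evaluate Ap B) (bd_fiber CC (PI B)) (bd_fiber CC B)" if "B \<in> Ob_ge2 CC" for B
    using L that unfolding CS_structures_def Let_def evaluate_def by auto
  have st: "pull CC f (PI B) = PI (pull CC f B)" "pull_mor CC f (Ap B) = Ap (pull CC f B)"
    if "B \<in> Ob_ge2 CC" "f \<in> Mor CC" "tgt CC f = ft CC (ft CC B)" for B f
    using *[OF that(1)] that src_in by (auto simp: hom_def)
  have fam1: "fam 1 (PI B) \<Gamma>" if B: "fam 2 B \<Gamma>" for B \<Gamma>
  proof -
    note B' = fam2_Ob_ge2[OF B]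
    have "0 < len CC (PI B)" by (rule CS_structure_positive[OF PO]) (use * st B' in auto)
    moreover have "PI B \<in> Ob CC" using PO B' by blast
    ultimately show ?thesis
      using *[OF B'] fam2D(4)[OF B] ft_in[of "PI B"] by (simp add: fam_Suc fam_0)
  qed
  have fam: "stable_family PI"
    unfolding stable_family_def using fam1 st(1) fam2_Ob_ge2 fam2D(4) by metis
  have "Ap B \<in> Mor CC \<and> src CC (Ap B) = pull CC (pr CC (ft CC B)) (PI B) \<and>
        tgt CC (Ap B) = B \<and> Ap B \<cdot> pr CC B = pr CC (pull CC (pr CC (ft CC B)) (PI B))" if B: "fam 2 B \<Gamma>" for B \<Gamma>
  proof -
    note f = fam2D[OF B]
    have "Ap B \<in> hom CC (fprod CC \<Gamma> (ft CC B) (PI B)) B" "mor_over CC (ft CC B) (Ap B)"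
      using *[OF fam2_Ob_ge2[OF B]] f(4) by auto
    then show ?thesis
      using fprod_eq[OF f(2), of "PI B"] fam1D[OF f(1)] fam1D[OF fam_pull_pr[OF f(2) fam1[OF B]]]
      by (simp add: hom_def mor_over_iff)
  qed
  then have "stable_application PI Ap"
    unfolding stable_application_def using st(2) fam2_Ob_ge2 fam2D(4) by metis
  then show ?R using * ext fam by blast
next
  assume R: ?R
  have "ft CC (PI B) = ft CC (ft CC B) \<and>
     (\<forall>\<Gamma>'\<in>Ob CC. \<forall>f\<in>hom CC \<Gamma>' (ft CC (ft CC B)). pull CC f (PI B) = PI (pull CC f B)) \<and>
     Ap B \<in> hom CC (fprod CC (ft CC (ft CC B)) (ft CC B) (PI B)) B \<and> mor_over CC (ft CC B) (Ap B) \<and>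
     (\<forall>\<Gamma>'\<in>Ob CC. \<forall>f\<in>hom CC \<Gamma>' (ft CC (ft CC B)). pull_mor CC f (Ap B) = Ap (pull CC f B)) \<and>
     bij_betw (\<lambda>s. pull_mor CC (pr CC (ft CC B)) s \<cdot> Ap B) (bd_fiber CC (PI B)) (bd_fiber CC B) \<and> PI B \<in> Ob CC \<and> Ap B \<in> Mor CC"
    if B: "B \<in> Ob_ge2 CC" for B
  proof (intro conjI ballI)
    note B' = B[unfolded Ob_ge2_iff] note f = fam2D[OF B']
    have P: "fam 1 (PI B) (ft CC (ft CC B))" using R B' unfolding stable_family_def by blast
    show "ft CC (PI B) = ft CC (ft CC B)" "PI B \<in> Ob CC" using fam1D[OF P] by auto
    have A: "Ap B \<in> Mor CC \<and> src CC (Ap B) = pull CC (pr CC (ft CC B)) (PI B) \<and> tgt CC (Ap B) = B"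
      using R B' unfolding stable_application_def by blast
    then show "Ap B \<in> Mor CC" by simp
    show "Ap B \<in> hom CC (fprod CC (ft CC (ft CC B)) (ft CC B) (PI B)) B"
      using A fprod_eq[OF f(2)] by (simp add: hom_def)
    show "mor_over CC (ft CC B) (Ap B)" using stable_application_mor_over R B' by blast
    show "bij_betw (\<lambda>s. pull_mor CC (pr CC (ft CC B)) s \<cdot> Ap B) (bd_fiber CC (PI B)) (bd_fiber CC B)"
      using R B unfolding evaluate_def[abs_def] by blast
    show "pull CC f (PI B) = PI (pull CC f B)" if "f \<in> hom CC \<Gamma>' (ft CC (ft CC B))" for f \<Gamma>'
      using that R B' unfolding stable_family_def hom_def by auto
    show "pull_mor CC f (Ap B) = Ap (pull CC f B)" if "f \<in> hom CC \<Gamma>' (ft CC (ft CC B))" for f \<Gamma>'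
      using that R B' unfolding stable_application_def hom_def by auto
  qed
  then show ?L using R unfolding CS_structures_def Let_def by (auto simp: PiE_def)
qed

section \<open>Pi-lambda structures as natural bijections between sections\<close>

lemma sect_Ob_psh: "\<Gamma> \<in> Ob CC \<Longrightarrow> X \<in> sect (Ob_psh CC n) \<Gamma> \<longleftrightarrow> fam n X \<Gamma>"
  by (simp add: fam_def)

lemma restr_psh [simp]: "restr (Ob_psh CC n) = pull CC" "restr (Obt_psh CC n) = pull_mor CC"
  by (simp_all add: Ob_psh_def Obt_psh_def)

lemma presheaf_Ob_psh: "presheaf CC (Ob_psh CC n)"
  unfolding presheaf_def using fam_pull[of _ n] fam_over[of n]
  by (auto simp: sect_Ob_psh hom_def pull_id pull_cmp)

lemma presheaf_Obt_psh: "presheaf CC (Obt_psh CC (Suc n))"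
proof -
  have 1: "pull_mor CC f s \<in> sect (Obt_psh CC (Suc n)) X \<and> tgt CC (pull_mor CC f s) = pull CC f (tgt CC s)
      \<and> mor_over CC (tgt CC f) s"
    if "f \<in> Mor CC" "src CC f = X" "s \<in> sect (Obt_psh CC (Suc n)) (tgt CC f)" for f s X
  proof -
    have s: "fam (Suc n) (tgt CC s) (tgt CC f)" "s \<in> bd_fiber CC (tgt CC s)"
      using that Obt_psh_iff[of "tgt CC f" s n] by auto
    note mo = section_mor_over[OF s]
    then have t: "tgt CC (pull_mor CC f s) = pull CC f (tgt CC s)" using that(1) by simp
    show ?thesis
      using that mo t pull_section[OF that(1) s] fam_pull[OF that(1) s(1)] Obt_psh_iff[of X "pull_mor CC f s" n] by auto
  qed
  show ?thesis unfolding presheaf_def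
  proof (intro conjI ballI)
    fix X s assume "X \<in> Ob CC" "s \<in> sect (Obt_psh CC (Suc n)) X"
    then show "restr (Obt_psh CC (Suc n)) (idm CC X) s = s"
      using 1[of "idm CC X" X s] by (simp add: pull_mor_id)
  next
    fix X Y Z f g s assume "f \<in> hom CC X Y" "g \<in> hom CC Y Z" "s \<in> sect (Obt_psh CC (Suc n)) Z"
    then show "restr (Obt_psh CC (Suc n)) (f \<cdot> g) s = restr (Obt_psh CC (Suc n)) f (restr (Obt_psh CC (Suc n)) g s)"
      using 1[of g Y s] pull_mor_comp_base[of g f s] by (auto simp: hom_def)
  qed (use 1 in \<open>auto simp: hom_def\<close>)
qed

lemma bd_psh_mor: "bd CC (Suc n) \<in> psh_mor CC (Obt_psh CC (Suc n)) (Ob_psh CC (Suc n))"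
  unfolding bd_def
proof (rule psh_morI)
  show "tgt CC s \<in> sect (Ob_psh CC (Suc n)) X" if "s \<in> sect (Obt_psh CC (Suc n)) X" for X s
    using that by (simp add: Obt_psh_def)
  fix X Y f s assume f: "X \<in> Ob CC" "Y \<in> Ob CC" "f \<in> hom CC X Y" "s \<in> sect (Obt_psh CC (Suc n)) Y"
  then have s: "fam (Suc n) (tgt CC s) Y" "s \<in> bd_fiber CC (tgt CC s)" using Obt_psh_iff[of Y s n] by auto
  note mo = section_mor_over[OF s]
  have "restr (Obt_psh CC (Suc n)) f s \<in> sect (Obt_psh CC (Suc n)) X"
    using presheaf_Obt_psh[of n] f unfolding presheaf_def by blast
  then show "restr (Obt_psh CC (Suc n)) f s \<in> sect (Obt_psh CC (Suc n)) X \<and>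
      tgt CC (restr (Obt_psh CC (Suc n)) f s) = restr (Ob_psh CC (Suc n)) f (tgt CC s)"
    using f mo by (simp add: hom_def)
qed

lemma sect_Obt_psh1: "\<Gamma> \<in> Ob CC \<Longrightarrow> s \<in> sect (Obt_psh CC 1) \<Gamma> \<longleftrightarrow> fam 1 (tgt CC s) \<Gamma> \<and> s \<in> bd_fiber CC (tgt CC s)"
  and sect_Obt_psh2: "\<Gamma> \<in> Ob CC \<Longrightarrow> s \<in> sect (Obt_psh CC 2) \<Gamma> \<longleftrightarrow> fam 2 (tgt CC s) \<Gamma> \<and> s \<in> bd_fiber CC (tgt CC s)"
  using Obt_psh_iff[of \<Gamma> s 0] Obt_psh_iff[of \<Gamma> s 1] by (simp_all add: numeral_2_eq_2)

lemma bd_fiber_tgt: "s \<in> bd_fiber CC X \<Longrightarrow> tgt CC s = X"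
  by (simp add: bd_fiber_def)

text \<open>A pullback of presheaves is a pullback at each object, and a pullback square of sets is a
  square whose horizontal map is bijective on the fibers of the vertical maps.\<close>

lemma Pi_lambda_structures_iff:
  "(PI, lam) \<in> Pi_lambda_structures CC \<longleftrightarrow>
     PI \<in> psh_mor CC (Ob_psh CC 2) (Ob_psh CC 1) \<and> lam \<in> psh_mor CC (Obt_psh CC 2) (Obt_psh CC 1) \<and>
     (\<forall>B \<Gamma>. fam 2 B \<Gamma> \<longrightarrow> bij_betw (lam \<Gamma>) (bd_fiber CC B) (bd_fiber CC (PI \<Gamma> B)))"
proof (cases "PI \<in> psh_mor CC (Ob_psh CC 2) (Ob_psh CC 1) \<and> lam \<in> psh_mor CC (Obt_psh CC 2) (Obt_psh CC 1)")
  case False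
  then show ?thesis unfolding Pi_lambda_structures_def by auto
next
  case True
  then have PI: "PI \<in> psh_mor CC (Ob_psh CC 2) (Ob_psh CC 1)" and lam: "lam \<in> psh_mor CC (Obt_psh CC 2) (Obt_psh CC 1)" by auto
  have psh: "presheaf CC (Obt_psh CC 2)" "presheaf CC (Obt_psh CC 1)"
      "bd CC 2 \<in> psh_mor CC (Obt_psh CC 2) (Ob_psh CC 2)" "bd CC 1 \<in> psh_mor CC (Obt_psh CC 1) (Ob_psh CC 1)"
    using presheaf_Obt_psh[of 1] presheaf_Obt_psh[of 0] bd_psh_mor[of 1] bd_psh_mor[of 0] by (simp_all add: numeral_2_eq_2)
  have lam_in: "fam 1 (tgt CC (lam \<Gamma> s)) \<Gamma> \<and> lam \<Gamma> s \<in> bd_fiber CC (tgt CC (lam \<Gamma> s))" if "fam 2 B \<Gamma>" "s \<in> bd_fiber CC B" for B \<Gamma> s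
    using psh_mor_sect[OF lam, of \<Gamma> s] that sect_Obt_psh1 sect_Obt_psh2 bd_fiber_tgt[OF that(2)] by (auto simp: fam_def)
  have PI_in: "fam 1 (PI \<Gamma> B) \<Gamma>" if "fam 2 B \<Gamma>" for B \<Gamma>
    using psh_mor_sect[OF PI, of \<Gamma> B] that by (auto simp: fam_def)
  have sq: "psh_cmp CC (Obt_psh CC 2) lam (bd CC 1) = psh_cmp CC (Obt_psh CC 2) (bd CC 2) PI \<longleftrightarrow>
    (\<forall>B \<Gamma> s. fam 2 B \<Gamma> \<longrightarrow> s \<in> bd_fiber CC B \<longrightarrow> tgt CC (lam \<Gamma> s) = PI \<Gamma> B)"
    (is "_ \<longleftrightarrow> ?tgt")
  proof -
    have "bd CC 1 \<Gamma> (lam \<Gamma> s) = tgt CC (lam \<Gamma> s)" "bd CC 2 \<Gamma> s = tgt CC s"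
      if "\<Gamma> \<in> Ob CC" "s \<in> sect (Obt_psh CC 2) \<Gamma>" for \<Gamma> s
      using psh_mor_sect[OF lam that] that by (simp_all add: bd_def)
    then have "psh_cmp CC (Obt_psh CC 2) lam (bd CC 1) = psh_cmp CC (Obt_psh CC 2) (bd CC 2) PI \<longleftrightarrow>
      (\<forall>\<Gamma>\<in>Ob CC. \<forall>s\<in>sect (Obt_psh CC 2) \<Gamma>. tgt CC (lam \<Gamma> s) = PI \<Gamma> (tgt CC s))"
      unfolding psh_cmp_eq_iff by simp
    also have "\<dots> \<longleftrightarrow> ?tgt"
      using sect_Obt_psh2 bd_fiber_tgt fam_def by metis
    finally show ?thesis .
  qed
  have pw: "(\<forall>\<Gamma>\<in>Ob CC. \<forall>s\<in>sect (Obt_psh CC 1) \<Gamma>. \<forall>B\<in>sect (Ob_psh CC 2) \<Gamma>. bd CC 1 \<Gamma> s = PI \<Gamma> B \<longrightarrow>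
       (\<exists>!r. r \<in> sect (Obt_psh CC 2) \<Gamma> \<and> lam \<Gamma> r = s \<and> bd CC 2 \<Gamma> r = B)) \<longleftrightarrow>
    (\<forall>B \<Gamma>. fam 2 B \<Gamma> \<longrightarrow> (\<forall>s\<in>bd_fiber CC (PI \<Gamma> B). \<exists>!r. r \<in> bd_fiber CC B \<and> lam \<Gamma> r = s))"
    (is "?all \<longleftrightarrow> _")
  proof -
    have a: "(s \<in> sect (Obt_psh CC 1) \<Gamma> \<and> bd CC 1 \<Gamma> s = PI \<Gamma> B) \<longleftrightarrow> s \<in> bd_fiber CC (PI \<Gamma> B)" if "fam 2 B \<Gamma>" for B \<Gamma> s
      using that PI_in[OF that] bd_fiber_tgt[of s "PI \<Gamma> B"] sect_Obt_psh1[of \<Gamma> s] by (auto simp: bd_def fam_def)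
    have b: "(r \<in> sect (Obt_psh CC 2) \<Gamma> \<and> lam \<Gamma> r = s \<and> bd CC 2 \<Gamma> r = B) \<longleftrightarrow> r \<in> bd_fiber CC B \<and> lam \<Gamma> r = s" if "fam 2 B \<Gamma>" for B \<Gamma> r s
      using that bd_fiber_tgt[of r B] sect_Obt_psh2[of \<Gamma> r] by (auto simp: bd_def fam_def)
    have "?all \<longleftrightarrow> (\<forall>B \<Gamma>. fam 2 B \<Gamma> \<longrightarrow> (\<forall>s. s \<in> sect (Obt_psh CC 1) \<Gamma> \<and> bd CC 1 \<Gamma> s = PI \<Gamma> B \<longrightarrow>
       (\<exists>!r. r \<in> sect (Obt_psh CC 2) \<Gamma> \<and> lam \<Gamma> r = s \<and> bd CC 2 \<Gamma> r = B)))"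
      unfolding fam_def by blast
    also have "\<dots> \<longleftrightarrow> (\<forall>B \<Gamma>. fam 2 B \<Gamma> \<longrightarrow> (\<forall>s\<in>bd_fiber CC (PI \<Gamma> B). \<exists>!r. r \<in> bd_fiber CC B \<and> lam \<Gamma> r = s))"
      by (simp add: a b Ball_def del: One_nat_def cong: imp_cong)
    finally show ?thesis .
  qed
  have "psh_pullback CC (Obt_psh CC 2) (Obt_psh CC 1) (Ob_psh CC 2) lam (bd CC 2) (bd CC 1) PI \<longleftrightarrow>
     (\<forall>B \<Gamma>. fam 2 B \<Gamma> \<longrightarrow> bij_betw (lam \<Gamma>) (bd_fiber CC B) (bd_fiber CC (PI \<Gamma> B)))"
    unfolding psh_pullback_iff_pointwise[OF category_axioms psh(1,2) presheaf_Ob_psh lam psh(3,4) PI] sq pw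
  proof (intro iffI conjI allI impI)
    fix B \<Gamma> assume H: "(\<forall>B \<Gamma> s. fam 2 B \<Gamma> \<longrightarrow> s \<in> bd_fiber CC B \<longrightarrow> tgt CC (lam \<Gamma> s) = PI \<Gamma> B) \<and>
       (\<forall>B \<Gamma>. fam 2 B \<Gamma> \<longrightarrow> (\<forall>s\<in>bd_fiber CC (PI \<Gamma> B). \<exists>!r. r \<in> bd_fiber CC B \<and> lam \<Gamma> r = s))" and B: "fam 2 B \<Gamma>"
    have in_fiber: "lam \<Gamma> s \<in> bd_fiber CC (PI \<Gamma> B)" if "s \<in> bd_fiber CC B" for s
      using H B lam_in[OF B that] that by metis
    show "bij_betw (lam \<Gamma>) (bd_fiber CC B) (bd_fiber CC (PI \<Gamma> B))"
      unfolding bij_betw_def inj_on_def using in_fiber H B by blast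
  next
    fix B \<Gamma> s assume H: "\<forall>B \<Gamma>. fam 2 B \<Gamma> \<longrightarrow> bij_betw (lam \<Gamma>) (bd_fiber CC B) (bd_fiber CC (PI \<Gamma> B))"
      and B: "fam 2 B \<Gamma>" and s: "s \<in> bd_fiber CC B"
    show "tgt CC (lam \<Gamma> s) = PI \<Gamma> B"
      using H B s bd_fiber_tgt bij_betwE by blast
  next
    fix B \<Gamma> assume H: "\<forall>B \<Gamma>. fam 2 B \<Gamma> \<longrightarrow> bij_betw (lam \<Gamma>) (bd_fiber CC B) (bd_fiber CC (PI \<Gamma> B))" and B: "fam 2 B \<Gamma>"
    then have inj: "inj_on (lam \<Gamma>) (bd_fiber CC B)" and im: "lam \<Gamma> ` bd_fiber CC B = bd_fiber CC (PI \<Gamma> B)"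
      by (auto simp: bij_betw_def)
    show "\<forall>s\<in>bd_fiber CC (PI \<Gamma> B). \<exists>!r. r \<in> bd_fiber CC B \<and> lam \<Gamma> r = s"
      unfolding im[symmetric] using inj by (auto dest: inj_onD)
  qed
  then show ?thesis using PI lam unfolding Pi_lambda_structures_def by simp
qed

section \<open>The correspondence\<close>

text \<open>The context \<open>\<Gamma>\<close> of \<open>B\<close> is recovered as \<open>ft\<^sup>2(B)\<close>, so the components \<open>\<Pi>\<^sub>\<Gamma>\<close> combine to one function
  of \<open>B\<close> alone.\<close>

definition family_of :: "('o \<Rightarrow> 'o \<Rightarrow> 'o) \<Rightarrow> 'o \<Rightarrow> 'o" where
  "family_of PI = (\<lambda>B\<in>Ob_ge2 CC. PI (ft CC (ft CC B)) B)"

definition unlam :: "('o \<Rightarrow> 'm \<Rightarrow> 'm) \<Rightarrow> 'o \<Rightarrow> 'm \<Rightarrow> 'm" where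
  "unlam lam B = inv_into (bd_fiber CC B) (lam (ft CC (ft CC B)))"

lemma family_of_eq: "fam 2 B \<Gamma> \<Longrightarrow> family_of PI B = PI \<Gamma> B"
  using fam2_Ob_ge2 fam2D(4) by (auto simp: family_of_def)

lemma stable_family_of:
  assumes PI: "PI \<in> psh_mor CC (Ob_psh CC 2) (Ob_psh CC 1)"
  shows "stable_family (family_of PI)"
  unfolding stable_family_def
proof (intro conjI allI impI)
  show "fam 1 (family_of PI B) \<Gamma>" if "fam 2 B \<Gamma>" for B \<Gamma>
    using psh_mor_sect[OF PI, of \<Gamma> B] that by (auto simp: fam_def family_of_eq[OF that])
  fix B f assume f: "f \<in> Mor CC" and B: "fam 2 B (tgt CC f)"
  note fB = fam2_pull(1)[OF f B refl]
  have "PI (src CC f) (pull CC f B) = pull CC f (PI (tgt CC f) B)"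
    using psh_mor_nat[OF PI, of "src CC f" "tgt CC f" f B] f B by (simp add: hom_def fam_def)
  then show "pull CC f (family_of PI B) = family_of PI (pull CC f B)"
    by (simp add: family_of_eq[OF B] family_of_eq[OF fB])
qed

lemma unlam:
  assumes "(PI, lam) \<in> Pi_lambda_structures CC" and B: "fam 2 B \<Gamma>"
  shows "bij_betw (unlam lam B) (bd_fiber CC (family_of PI B)) (bd_fiber CC B)"
    and "r \<in> bd_fiber CC B \<Longrightarrow> unlam lam B (lam \<Gamma> r) = r"
    and "s \<in> bd_fiber CC (family_of PI B) \<Longrightarrow> lam \<Gamma> (unlam lam B s) = s"
proof -
  have "bij_betw (lam \<Gamma>) (bd_fiber CC B) (bd_fiber CC (family_of PI B))"
    using assms family_of_eq[OF B] unfolding Pi_lambda_structures_iff by auto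
  then show "bij_betw (unlam lam B) (bd_fiber CC (family_of PI B)) (bd_fiber CC B)"
    and "r \<in> bd_fiber CC B \<Longrightarrow> unlam lam B (lam \<Gamma> r) = r"
    and "s \<in> bd_fiber CC (family_of PI B) \<Longrightarrow> lam \<Gamma> (unlam lam B s) = s"
    unfolding unlam_def fam2D(4)[OF B]
    by (auto simp: bij_betw_inv_into bij_betw_inv_into_left bij_betw_inv_into_right)
qed

lemma unlam_natural:
  assumes PL: "(PI, lam) \<in> Pi_lambda_structures CC"
  shows "natural_map (family_of PI) (unlam lam)"
  unfolding natural_map_def
proof (intro conjI allI impI)
  show in_fiber: "unlam lam B s \<in> bd_fiber CC B" if "fam 2 B \<Gamma>" "s \<in> bd_fiber CC (family_of PI B)" for B \<Gamma> s
    using unlam(1)[OF PL that(1)] that(2) bij_betwE by blast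
  fix B f s assume f: "f \<in> Mor CC" and B: "fam 2 B (tgt CC f)" and s: "s \<in> bd_fiber CC (family_of PI B)"
  note r = in_fiber[OF B s]
  have lam: "lam \<in> psh_mor CC (Obt_psh CC 2) (Obt_psh CC 1)" using PL unfolding Pi_lambda_structures_iff by blast
  have "unlam lam B s \<in> sect (Obt_psh CC 2) (tgt CC f)" using r B bd_fiber_tgt[OF r] f by (simp add: sect_Obt_psh2)
  then have "lam (src CC f) (pull_mor CC f (unlam lam B s)) = pull_mor CC f (lam (tgt CC f) (unlam lam B s))"
    using psh_mor_nat[OF lam, of "src CC f" "tgt CC f" f "unlam lam B s"] f by (simp add: hom_def)
  then have "lam (src CC f) (pull_mor CC f (unlam lam B s)) = pull_mor CC f s"
    using unlam(3)[OF PL B s] by simp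
  moreover have "pull_mor CC f (unlam lam B s) \<in> bd_fiber CC (pull CC f B)"
    using pull_section[of f 1 B "unlam lam B s"] f B r by (simp add: numeral_2_eq_2)
  ultimately show "pull_mor CC f (unlam lam B s) = unlam lam (pull CC f B) (pull_mor CC f s)"
    using unlam(2)[OF PL fam2_pull(1)[OF f B refl]] by metis
qed

text \<open>The element \<open>ap\<^sub>B\<close> is the preimage of the diagonal under the bijection \<open>\<lambda>\<close> from the sections of \<open>P \<times>\<^sub>\<Gamma> B\<close> to
  those of \<open>P \<times>\<^sub>\<Gamma> P\<close>.\<close>

lemma is_ap_iff:
  assumes PL: "(PI, lam) \<in> Pi_lambda_structures CC" and B: "fam 2 B \<Gamma>"
  defines "P \<equiv> family_of PI B"
  shows "is_ap CC lam \<Gamma> P B s \<longleftrightarrow> s = unlam lam (pull CC (pr CC P) B) (diagonal CC \<Gamma> P)"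
proof -
  let ?B' = "pull CC (pr CC P) B"
  have PI: "PI \<in> psh_mor CC (Ob_psh CC 2) (Ob_psh CC 1)" using PL unfolding Pi_lambda_structures_iff by blast
  note P_st = stable_family_of[OF PI]
  note B' = ap_section[OF P_st unlam_natural[OF PL] B, folded P_def]
  have P: "fam 1 P \<Gamma>" using P_st B unfolding stable_family_def P_def by blast
  have d: "diagonal CC \<Gamma> P \<in> bd_fiber CC (family_of PI ?B')" using diagonal(1)[OF P] B'(1) by simp
  have "is_ap CC lam \<Gamma> P B s \<longleftrightarrow> s \<in> bd_fiber CC ?B' \<and> lam P s = diagonal CC \<Gamma> P"
    using B'(3) bd_fiber_tgt[of s ?B'] fam1D[OF P]
    by (auto simp: is_ap_def bd_def sect_Obt_psh2 fprod_eq[OF P])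
  then show ?thesis
    using unlam(2,3)[OF PL B'(3)] d B'(4) by metis
qed

lemma CS_of_Pi_lambda_eq:
  assumes PL: "(PI, lam) \<in> Pi_lambda_structures CC"
  shows "CS_of_Pi_lambda CC (PI, lam) =
    (family_of PI, \<lambda>B\<in>Ob_ge2 CC. application_of (family_of PI) (unlam lam) B)"
proof -
  have "(let A = ft CC B; \<Gamma> = ft CC A; P = PI \<Gamma> B in exch CC \<Gamma> A P \<cdot> ap CC lam \<Gamma> P B \<cdot> q CC (pr CC P) B)
     = application_of (family_of PI) (unlam lam) B" if "B \<in> Ob_ge2 CC" for B
  proof -
    have B: "fam 2 B (ft CC (ft CC B))" using that Ob_ge2_iff by simp
    show ?thesis
      unfolding Let_def application_of_def ap_def family_of_eq[OF B, symmetric] is_ap_iff[OF PL B] by simp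
  qed
  then show ?thesis by (auto simp: CS_of_Pi_lambda_def family_of_def[abs_def] intro!: restrict_ext)
qed

lemma CS_of_Pi_lambda_CS:
  assumes PL: "(PI, lam) \<in> Pi_lambda_structures CC"
  shows "CS_of_Pi_lambda CC (PI, lam) \<in> CS_structures CC"
proof -
  let ?P = "family_of PI" and ?Ap = "\<lambda>B\<in>Ob_ge2 CC. application_of (family_of PI) (unlam lam) B"
  have P: "stable_family ?P" using stable_family_of PL unfolding Pi_lambda_structures_iff by blast
  note \<phi> = unlam_natural[OF PL]
  have "stable_application ?P ?Ap"
    by (rule stable_application_cong[OF _ application_of_stable[OF P \<phi>]]) simp
  moreover have "bij_betw (evaluate ?Ap B) (bd_fiber CC (?P B)) (bd_fiber CC B)" if "B \<in> Ob_ge2 CC" for B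
  proof -
    have B: "fam 2 B (ft CC (ft CC B))" using that Ob_ge2_iff by simp
    have "evaluate ?Ap B s = unlam lam B s" if "s \<in> bd_fiber CC (?P B)" for s
      using evaluate_application_of[OF P \<phi> B that] \<open>B \<in> Ob_ge2 CC\<close> by (simp add: evaluate_def)
    then show ?thesis using unlam(1)[OF PL B] bij_betw_cong by blast
  qed
  ultimately show ?thesis
    unfolding CS_of_Pi_lambda_eq[OF PL] CS_structures_iff using P by (simp add: family_of_def)
qed

text \<open>By \<open>evaluate_application_of\<close>, \<open>\<lambda>\<^sup>-\<^sup>1\<close> is recovered from \<open>Ap\<close>.\<close>

lemma CS_of_Pi_lambda_inj: "inj_on (CS_of_Pi_lambda CC) (Pi_lambda_structures CC)"
proof (rule inj_onI, clarify)
  fix PI lam PI' lam'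
  assume PL: "(PI, lam) \<in> Pi_lambda_structures CC" and PL': "(PI', lam') \<in> Pi_lambda_structures CC"
    and eq: "CS_of_Pi_lambda CC (PI, lam) = CS_of_Pi_lambda CC (PI', lam')"
  have fam_eq: "family_of PI' = family_of PI"
    using eq unfolding CS_of_Pi_lambda_eq[OF PL] CS_of_Pi_lambda_eq[OF PL'] by simp
  have "restrict (application_of (family_of PI) (unlam lam)) (Ob_ge2 CC)
      = restrict (application_of (family_of PI) (unlam lam')) (Ob_ge2 CC)"
    using eq unfolding CS_of_Pi_lambda_eq[OF PL] CS_of_Pi_lambda_eq[OF PL'] fam_eq by simp
  then have Ap_eq: "application_of (family_of PI) (unlam lam) B = application_of (family_of PI) (unlam lam') B"
    if "B \<in> Ob_ge2 CC" for B
    using that by (metis restrict_apply')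
  have PI: "PI \<in> psh_mor CC (Ob_psh CC 2) (Ob_psh CC 1)" "PI' \<in> psh_mor CC (Ob_psh CC 2) (Ob_psh CC 1)"
    and lam: "lam \<in> psh_mor CC (Obt_psh CC 2) (Obt_psh CC 1)" "lam' \<in> psh_mor CC (Obt_psh CC 2) (Obt_psh CC 1)"
    using PL PL' unfolding Pi_lambda_structures_iff by auto
  have "PI = PI'"
    by (rule psh_mor_eqI[OF PI]) (metis family_of_eq fam_eq fam_def)
  moreover have "lam = lam'"
  proof (rule psh_mor_eqI[OF lam])
    fix \<Gamma> r assume "\<Gamma> \<in> Ob CC" "r \<in> sect (Obt_psh CC 2) \<Gamma>"
    then have B: "fam 2 (tgt CC r) \<Gamma>" and r: "r \<in> bd_fiber CC (tgt CC r)" by (auto simp: sect_Obt_psh2)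
    note P = stable_family_of[OF PI(1)]
    have \<phi>: "natural_map (family_of PI) (unlam lam)" "natural_map (family_of PI) (unlam lam')"
      using unlam_natural[OF PL] unlam_natural[OF PL'] fam_eq by simp_all
    have s: "lam \<Gamma> r \<in> bd_fiber CC (family_of PI (tgt CC r))"
      using PL B r family_of_eq[OF B] bij_betwE unfolding Pi_lambda_structures_iff by metis
    have "evaluate (application_of (family_of PI) (unlam lam)) (tgt CC r) (lam \<Gamma> r)
       = evaluate (application_of (family_of PI) (unlam lam')) (tgt CC r) (lam \<Gamma> r)"
      using Ap_eq[OF fam2_Ob_ge2[OF B]] by (simp add: evaluate_def)
    then have "unlam lam (tgt CC r) (lam \<Gamma> r) = unlam lam' (tgt CC r) (lam \<Gamma> r)"
      using evaluate_application_of[OF P _ B s] \<phi> by simp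
    then show "lam \<Gamma> r = lam' \<Gamma> r"
      using unlam(2)[OF PL B r] unlam(3)[OF PL' B, of "lam \<Gamma> r"] s fam_eq by simp
  qed
  ultimately show "PI = PI' \<and> lam = lam'" by simp
qed

text \<open>The preimage of \<open>(P, Ap)\<close> has as \<open>\<lambda>\<close> the inverse of evaluation, which is natural because evaluation is.\<close>

lemma CS_of_Pi_lambda_surj:
  assumes CS: "(P, Ap) \<in> CS_structures CC"
  shows "\<exists>(PI, lam)\<in>Pi_lambda_structures CC. CS_of_Pi_lambda CC (PI, lam) = (P, Ap)"
proof -
  have ext: "P \<in> extensional (Ob_ge2 CC)" "Ap \<in> extensional (Ob_ge2 CC)"
    and P: "stable_family P" and Ap: "stable_application P Ap"
    and bij: "\<And>B \<Gamma>. fam 2 B \<Gamma> \<Longrightarrow> bij_betw (evaluate Ap B) (bd_fiber CC (P B)) (bd_fiber CC B)"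
    using CS fam2_Ob_ge2 unfolding CS_structures_iff by auto
  note \<phi> = evaluate_natural[OF P Ap]
  define L where "L r = inv_into (bd_fiber CC (P (tgt CC r))) (evaluate Ap (tgt CC r)) r" for r
  define PI where "PI = (\<lambda>\<Gamma>\<in>Ob CC. \<lambda>B\<in>sect (Ob_psh CC 2) \<Gamma>. P B)"
  define lam where "lam = (\<lambda>\<Gamma>\<in>Ob CC. \<lambda>r\<in>sect (Obt_psh CC 2) \<Gamma>. L r)"
  have P1: "fam 1 (P B) \<Gamma>" if "fam 2 B \<Gamma>" for B \<Gamma> using P that unfolding stable_family_def by blast
  have PI_eq: "PI \<Gamma> B = P B" if "fam 2 B \<Gamma>" for B \<Gamma> using that by (auto simp: PI_def fam_def)
  have lam_eq: "lam \<Gamma> r = L r" if "fam 2 B \<Gamma>" "r \<in> bd_fiber CC B" for B \<Gamma> r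
    using that bd_fiber_tgt[OF that(2)] sect_Obt_psh2[of \<Gamma> r] by (auto simp: lam_def fam_def)
  have L: "L r \<in> bd_fiber CC (P B)" "evaluate Ap B (L r) = r" if "fam 2 B \<Gamma>" "r \<in> bd_fiber CC B" for B \<Gamma> r
    using bij[OF that(1)] that(2) bd_fiber_tgt[OF that(2)] unfolding L_def
    by (auto simp: bij_betw_inv_into_right bij_betw_def intro: inv_into_into)
  have L_eq: "L (evaluate Ap B s) = s" if "fam 2 B \<Gamma>" "s \<in> bd_fiber CC (P B)" for B \<Gamma> s
  proof -
    have "evaluate Ap B s \<in> bd_fiber CC B" using bij[OF that(1)] that(2) bij_betwE by blast
    then show ?thesis
      using bij_betw_inv_into_left[OF bij[OF that(1)] that(2)] bd_fiber_tgt unfolding L_def by metis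
  qed
  have PI: "PI \<in> psh_mor CC (Ob_psh CC 2) (Ob_psh CC 1)" unfolding PI_def
  proof (rule psh_morI)
    show "P B \<in> sect (Ob_psh CC 1) \<Gamma>" if "\<Gamma> \<in> Ob CC" "B \<in> sect (Ob_psh CC 2) \<Gamma>" for \<Gamma> B
      using P1[of B \<Gamma>] that by (simp add: fam_def)
    fix X Y f B assume H: "X \<in> Ob CC" "Y \<in> Ob CC" "f \<in> hom CC X Y" "B \<in> sect (Ob_psh CC 2) Y"
    then have f: "f \<in> Mor CC" "src CC f = X" "fam 2 B (tgt CC f)" by (auto simp: hom_def fam_def)
    show "restr (Ob_psh CC 2) f B \<in> sect (Ob_psh CC 2) X \<and> P (restr (Ob_psh CC 2) f B) = restr (Ob_psh CC 1) f (P B)"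
      using P f fam2_pull(1)[OF f(1,3,2)] unfolding stable_family_def by (simp add: fam_def)
  qed
  have lam: "lam \<in> psh_mor CC (Obt_psh CC 2) (Obt_psh CC 1)" unfolding lam_def
  proof (rule psh_morI)
    fix \<Gamma> r assume "\<Gamma> \<in> Ob CC" "r \<in> sect (Obt_psh CC 2) \<Gamma>"
    then have B: "fam 2 (tgt CC r) \<Gamma>" and r: "r \<in> bd_fiber CC (tgt CC r)" and \<Gamma>: "\<Gamma> \<in> Ob CC" by (auto simp: sect_Obt_psh2)
    show "L r \<in> sect (Obt_psh CC 1) \<Gamma>"
      using L(1)[OF B r] P1[OF B] bd_fiber_tgt[OF L(1)[OF B r]] unfolding sect_Obt_psh1[OF \<Gamma>] by simp
  next
    fix X Y f r assume H: "X \<in> Ob CC" "Y \<in> Ob CC" "f \<in> hom CC X Y" "r \<in> sect (Obt_psh CC 2) Y"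
    let ?B = "tgt CC r"
    have f: "f \<in> Mor CC" "src CC f = X" "tgt CC f = Y" using H by (auto simp: hom_def)
    have B: "fam 2 ?B (tgt CC f)" and r: "r \<in> bd_fiber CC ?B" using H f by (auto simp: sect_Obt_psh2)
    note fB = fam2_pull(1)[OF f(1) B f(2)]
    have fr: "pull_mor CC f r \<in> bd_fiber CC (pull CC f ?B)" using pull_section[of f 1 ?B r] f B r by (simp add: numeral_2_eq_2)
    have fL: "pull_mor CC f (L r) \<in> bd_fiber CC (P (pull CC f ?B))"
      using pull_section[of f 0 "P ?B" "L r"] f P1[OF B] L(1)[OF B r] P B unfolding stable_family_def by simp
    have "pull_mor CC f r = evaluate Ap (pull CC f ?B) (pull_mor CC f (L r))"
      using \<phi> f(1) B L[OF B r] unfolding natural_map_def by metis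
    then have "L (pull_mor CC f r) = pull_mor CC f (L r)" using L_eq[OF fB fL] by simp
    moreover have "pull_mor CC f r \<in> sect (Obt_psh CC 2) X" using fr fB bd_fiber_tgt[OF fr] H(1) by (simp add: sect_Obt_psh2)
    ultimately show "restr (Obt_psh CC 2) f r \<in> sect (Obt_psh CC 2) X \<and> L (restr (Obt_psh CC 2) f r) = restr (Obt_psh CC 1) f (L r)"
      by simp
  qed
  have "bij_betw (lam \<Gamma>) (bd_fiber CC B) (bd_fiber CC (PI \<Gamma> B))" if B: "fam 2 B \<Gamma>" for B \<Gamma>
    by (rule bij_betw_byWitness[where f' = "evaluate Ap B"])
      (use L[OF B] L_eq[OF B] lam_eq[OF B] PI_eq[OF B] bij_betwE[OF bij[OF B]] in auto)
  then have PL: "(PI, lam) \<in> Pi_lambda_structures CC" using PI lam by (simp add: Pi_lambda_structures_iff)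
  have fam_eq: "family_of PI = P"
    using ext(1) PI_eq Ob_ge2_iff by (auto simp: family_of_def extensional_def fun_eq_iff)
  have unlam_eq: "unlam lam B s = evaluate Ap B s" if "fam 2 B \<Gamma>" "s \<in> bd_fiber CC (P B)" for B \<Gamma> s
  proof -
    have r: "evaluate Ap B s \<in> bd_fiber CC B" using bij[OF that(1)] that(2) bij_betwE by blast
    then show ?thesis using unlam(2)[OF PL that(1) r] lam_eq[OF that(1) r] L_eq[OF that] by simp
  qed
  have "application_of P (unlam lam) B = Ap B" if "B \<in> Ob_ge2 CC" for B
  proof -
    have B: "fam 2 B (ft CC (ft CC B))" using that Ob_ge2_iff by simp
    note B' = ap_section[OF P \<phi> B]
    have "diagonal CC (ft CC (ft CC B)) (P B) \<in> bd_fiber CC (P (pull CC (pr CC (P B)) B))"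
      using diagonal(1)[OF P1[OF B]] B'(1) by simp
    then have "application_of P (unlam lam) B = application_of P (evaluate Ap) B"
      using unlam_eq[OF B'(3)] by (simp add: application_of_def)
    then show ?thesis using application_of_evaluate[OF P Ap B] by simp
  qed
  then have "CS_of_Pi_lambda CC (PI, lam) = (P, Ap)"
    unfolding CS_of_Pi_lambda_eq[OF PL] fam_eq using ext(2) by (auto simp: extensional_def fun_eq_iff)
  then show ?thesis using PL by auto
qed

end

theorem mainTheorem1:
  fixes CC :: "('o, 'm) csys"
  assumes "csystem CC"
  shows "(\<forall>(PI, lam)\<in>Pi_lambda_structures CC. \<forall>B\<in>Ob_ge2 CC.
            let \<Gamma> = ft CC (ft CC B); P = PI \<Gamma> B in
              (\<exists>!d. is_diagonal CC \<Gamma> P d) \<and> (\<exists>!s. is_ap CC lam \<Gamma> P B s)) \<and>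
         bij_betw (CS_of_Pi_lambda CC) (Pi_lambda_structures CC) (CS_structures CC)"
proof -
  interpret csystem CC by fact
  have "let \<Gamma> = ft CC (ft CC B); P = PI \<Gamma> B in
      (\<exists>!d. is_diagonal CC \<Gamma> P d) \<and> (\<exists>!s. is_ap CC lam \<Gamma> P B s)"
    if PL: "(PI, lam) \<in> Pi_lambda_structures CC" and "B \<in> Ob_ge2 CC" for PI lam B
  proof -
    have B: "fam 2 B (ft CC (ft CC B))" using that Ob_ge2_iff by simp
    have "PI \<in> psh_mor CC (Ob_psh CC 2) (Ob_psh CC 1)" using PL unfolding Pi_lambda_structures_iff by blast
    then have "fam 1 (family_of PI B) (ft CC (ft CC B))"
      using stable_family_of B unfolding stable_family_def by blast
    then show ?thesis
      unfolding Let_def family_of_eq[OF B, symmetric] is_ap_iff[OF PL B] using diagonal_ex1 by blast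
  qed
  moreover have "bij_betw (CS_of_Pi_lambda CC) (Pi_lambda_structures CC) (CS_structures CC)"
    unfolding bij_betw_def
  proof (intro conjI equalityI subsetI)
    show "inj_on (CS_of_Pi_lambda CC) (Pi_lambda_structures CC)" by (rule CS_of_Pi_lambda_inj)
    show "x \<in> CS_structures CC" if "x \<in> CS_of_Pi_lambda CC ` Pi_lambda_structures CC" for x
      using that CS_of_Pi_lambda_CS by auto
    show "x \<in> CS_of_Pi_lambda CC ` Pi_lambda_structures CC" if "x \<in> CS_structures CC" for x
      using that CS_of_Pi_lambda_surj[of "fst x" "snd x"] by force
  qed
  ultimately show ?thesis by blast
qed

end
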